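(* Let $\sigma:\mathbb{R}\to\mathbb{R}$ be an analytic function, and assume there exists $c_0>0$ such that $\sigma(\alpha)\ge c_0$ for all $\alpha\in\mathbb{R}$. Let $E:X\to\mathbb{R}$, $E[u,\alpha]=\sigma(\alpha)\int_0^1\sqrt{1+|u_x(x)|^2}\,dx$, and let $(\overline{u},\overline{\alpha})\in Y$ be a critical point of $E$. Then there exist a neighborhood $U$ of $(\overline{u},\overline{\alpha})$ in $Y$ and constants $0<\theta\le\frac12$ and $C>0$ such that $$\|\dot{E}(u,\alpha)\|_{Y}\ge C\,\bigl|E[u,\alpha]-E[\overline{u},\overline{\alpha}]\bigr|^{1-\theta}\qquad\text{for all }(u,\alpha)\in U.$$ Here the Fréchet derivative $\dot{E}$ is explicitly $$\dot{E}(u,\alpha)=\left(\sigma(\alpha)\left\{\int_{0}^{x}\frac{u_{x}(y)}{\sqrt{1+u_{x}^{2}(y)}}\,dy-\int_{0}^{1}\int_{0}^{x}\frac{u_{x}(y)}{\sqrt{1+u_{x}^{2}(y)}}\,dy\,dx\right\},\ \sigma'(\alpha)\int_{0}^{1}\sqrt{1+u_{x}^{2}(x)}\,dx\right).$$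
   Context: Let $\mathbb{T}=\mathbb{R}/\mathbb{Z}$. For $k=1,2$ let $$H^k_{\mathrm{per.ave}}(0,1)=\Bigl\{u\in H^k(0,1): u_x\in H^{k-1}(\mathbb{T}),\ \int_0^1u(x)\,dx=0\Bigr\},$$ with $H^0(\mathbb{T})=L^2(\mathbb{T})$ (so for $k=2$ the derivative $u_x$ is periodic; $u$ itself need not be periodic). Put $X=H^1_{\mathrm{per.ave}}(0,1)\times\mathbb{R}$ and $Y=H^2_{\mathrm{per.ave}}(0,1)\times\mathbb{R}$, which are Hilbert spaces with inner products $$((u,\alpha),(v,\beta))_X=\int_0^1u_xv_x\,dx+\alpha\beta,\qquad ((u,\alpha),(v,\beta))_Y=\int_0^1u_xv_x\,dx+\int_0^1u_{xx}v_{xx}\,dx+\alpha\beta.$$ The Fréchet derivative $\dot E(u,\alpha)\in X$ is the element satisfying $E[u+h,\alpha+\beta]-E[u,\alpha]-(\dot E(u,\alpha),(h,\beta))_X=o(\|(h,\beta)\|_X)$ as $(h,\beta)\to0$ in $X$. A point $(\overline u,\overline\alpha)$ is a critical point of $E$ if $\dot E(\overline u,\overline\alpha)=0$. *)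

theory Defs
  imports "HOL-Analysis.Analysis"
begin

section \<open>Sobolev spaces on the unit interval and on the circle\<close>

text \<open>
  Functions on \<open>(0,1)\<close> are represented by functions on the real line whose values outside
  \<open>(0,1)\<close> are ignored; a function on the circle is identified with its restriction to the
  fundamental domain \<open>(0,1)\<close>. All integrals are Lebesgue integrals.
\<close>

abbreviation I01 :: "real measure" where
  "I01 \<equiv> lebesgue_on {0<..<1}"

definition L2 :: "(real \<Rightarrow> real) set" where
  "L2 = {f \<in> borel_measurable I01. integrable I01 (\<lambda>x. (f x)\<^sup>2)}"

text \<open>
  As usual in one dimension, weak derivatives are tested against \<open>C\<^sup>1\<close> functions: with compact
  support in \<open>(0,1)\<close> for the interval, and 1-periodic for the circle.
\<close>

definition test_interval :: "(real \<Rightarrow> real) \<Rightarrow> bool" where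
  "test_interval \<phi> \<longleftrightarrow> \<phi> C1_differentiable_on UNIV \<and> closure {x. \<phi> x \<noteq> 0} \<subseteq> {0<..<1}"

definition test_circle :: "(real \<Rightarrow> real) \<Rightarrow> bool" where
  "test_circle \<phi> \<longleftrightarrow> \<phi> C1_differentiable_on UNIV \<and> (\<forall>x. \<phi> (x + 1) = \<phi> x)"

definition weak_deriv_interval :: "(real \<Rightarrow> real) \<Rightarrow> (real \<Rightarrow> real) \<Rightarrow> bool" where
  "weak_deriv_interval u v \<longleftrightarrow>
     (\<forall>\<phi>. test_interval \<phi> \<longrightarrow> (LINT x|I01. u x * deriv \<phi> x) = - (LINT x|I01. v x * \<phi> x))"

definition weak_deriv_circle :: "(real \<Rightarrow> real) \<Rightarrow> (real \<Rightarrow> real) \<Rightarrow> bool" where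
  "weak_deriv_circle u v \<longleftrightarrow>
     (\<forall>\<phi>. test_circle \<phi> \<longrightarrow> (LINT x|I01. u x * deriv \<phi> x) = - (LINT x|I01. v x * \<phi> x))"

primrec H_interval :: "nat \<Rightarrow> (real \<Rightarrow> real) set" where
  "H_interval 0 = L2"
| "H_interval (Suc k) = {u \<in> L2. \<exists>v \<in> H_interval k. weak_deriv_interval u v}"

primrec H_circle :: "nat \<Rightarrow> (real \<Rightarrow> real) set" where
  "H_circle 0 = L2"
| "H_circle (Suc k) = {u \<in> L2. \<exists>v \<in> H_circle k. weak_deriv_circle u v}"

text \<open>A fixed version of the weak derivative, which is unique up to null sets.\<close>

definition wderiv :: "(real \<Rightarrow> real) \<Rightarrow> real \<Rightarrow> real" where
  "wderiv u = (SOME v. v \<in> L2 \<and> weak_deriv_interval u v)"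

text \<open>The periodicity condition is imposed on the derivative only. Intended for \<open>k \<ge> 1\<close>.\<close>

definition H_per_ave :: "nat \<Rightarrow> (real \<Rightarrow> real) set" where
  "H_per_ave k = {u \<in> H_interval k. wderiv u \<in> H_circle (k - 1) \<and> (LINT x|I01. u x) = 0}"


subsection \<open>Square integrable functions\<close>

lemma finite_measure_I01: "finite_measure I01"
  by (rule finite_measure_lebesgue_on) simp

lemma L2_mult:
  assumes "f \<in> L2" "g \<in> L2"
  shows "integrable I01 (\<lambda>x. f x * g x)"
proof (rule Bochner_Integration.integrable_bound)
  show "integrable I01 (\<lambda>x. (f x)\<^sup>2 + (g x)\<^sup>2)"
    using assms by (auto simp: L2_def)
  show "(\<lambda>x. f x * g x) \<in> borel_measurable I01"
    using assms by (auto simp: L2_def intro!: borel_measurable_times)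
  have "\<bar>a * b\<bar> \<le> a\<^sup>2 + b\<^sup>2" for a b :: real
  proof -
    have "2 * (\<bar>a\<bar> * \<bar>b\<bar>) \<le> a\<^sup>2 + b\<^sup>2"
      using sum_squares_bound[of "\<bar>a\<bar>" "\<bar>b\<bar>"] by (simp add: mult.assoc)
    moreover have "0 \<le> \<bar>a\<bar> * \<bar>b\<bar>" by simp
    ultimately show ?thesis unfolding abs_mult by linarith
  qed
  then show "AE x in I01. norm (f x * g x) \<le> norm ((f x)\<^sup>2 + (g x)\<^sup>2)"
    by (intro AE_I2) simp
qed

lemma L2_const: "(\<lambda>_. c) \<in> L2"
  using finite_measure.integrable_const[OF finite_measure_I01] by (simp add: L2_def)

lemma L2_integrable: "f \<in> L2 \<Longrightarrow> integrable I01 f"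
  using L2_mult[OF _ L2_const[of 1]] by simp

lemma L2_scale: "f \<in> L2 \<Longrightarrow> (\<lambda>x. c * f x) \<in> L2"
  by (auto simp: L2_def power_mult_distrib)

lemma L2_add:
  assumes "f \<in> L2" "g \<in> L2"
  shows "(\<lambda>x. f x + g x) \<in> L2"
proof -
  have "integrable I01 (\<lambda>x. (f x)\<^sup>2 + (g x)\<^sup>2 + 2 * (f x * g x))"
    using assms L2_mult[OF assms] by (auto simp: L2_def)
  then have "integrable I01 (\<lambda>x. (f x + g x)\<^sup>2)"
    by (simp add: power2_sum mult.assoc)
  then show ?thesis
    using assms by (auto simp: L2_def)
qed

lemma L2_continuous:
  assumes "continuous_on UNIV f"
  shows "f \<in> L2"
proof -
  have m: "f \<in> borel_measurable I01"
    using assms by (intro measurable_restrict_space1 measurable_completion)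
      (simp add: borel_measurable_continuous_onI)
  have "bounded (f ` {0..1})"
    by (intro compact_imp_bounded compact_continuous_image continuous_on_subset[OF assms]) auto
  then obtain B where B: "\<And>x. x \<in> {0..1} \<Longrightarrow> \<bar>f x\<bar> \<le> B"
    by (force simp: bounded_iff)
  have "integrable I01 (\<lambda>x. (f x)\<^sup>2)"
  proof (rule finite_measure.integrable_const_bound[OF finite_measure_I01, where B = "B\<^sup>2"])
    show "AE x in I01. norm ((f x)\<^sup>2) \<le> B\<^sup>2"
      by (rule AE_I2) (auto intro!: power2_le_iff_abs_le[THEN iffD2] B order_trans[OF abs_ge_zero B])
  qed (use m in auto)
  with m show ?thesis by (simp add: L2_def)
qed

lemma C1_UNIV:
  fixes \<phi> :: "real \<Rightarrow> real"
  assumes "\<phi> C1_differentiable_on UNIV"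
  shows "(\<phi> has_real_derivative deriv \<phi> x) (at x)" "continuous_on UNIV (deriv \<phi>)"
    "continuous_on UNIV \<phi>"
proof -
  obtain D where D: "\<And>x. (\<phi> has_real_derivative D x) (at x)" "continuous_on UNIV D"
    using assms by (auto simp: C1_differentiable_on_def has_real_derivative_iff_has_vector_derivative)
  have "deriv \<phi> = D"
    using D(1) by (auto intro: DERIV_imp_deriv)
  then show "(\<phi> has_real_derivative deriv \<phi> x) (at x)" "continuous_on UNIV (deriv \<phi>)"
    "continuous_on UNIV \<phi>"
    using D by (auto intro: DERIV_continuous_on)
qed

lemma C1_L2:
  assumes "\<phi> C1_differentiable_on UNIV"
  shows "\<phi> \<in> L2" "deriv \<phi> \<in> L2"
  using C1_UNIV[OF assms] by (auto intro: L2_continuous)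

lemma test_interval_C1: "test_interval \<phi> \<Longrightarrow> \<phi> C1_differentiable_on UNIV"
  by (simp add: test_interval_def)


subsection \<open>The fundamental lemma of the calculus of variations\<close>

lemma C1I:
  fixes f :: "real \<Rightarrow> real"
  assumes "\<And>x. (f has_real_derivative D x) (at x)" "continuous_on UNIV D"
  shows "f C1_differentiable_on UNIV"
  using assms by (auto simp: C1_differentiable_on_def has_real_derivative_iff_has_vector_derivative)

definition bump :: "real \<Rightarrow> real \<Rightarrow> real \<Rightarrow> real" where
  "bump a b x = (max 0 ((x - a) * (b - x)))\<^sup>2"

lemma max0_square_deriv:
  "((\<lambda>t::real. (max 0 t)\<^sup>2) has_real_derivative 2 * max 0 t) (at t)"
proof (cases "t = 0")
  case True
  have "((\<lambda>h::real. (max 0 h)\<^sup>2 / h) \<longlongrightarrow> 0) (at 0)"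
  proof (rule Lim_null_comparison)
    show "\<forall>\<^sub>F h in at 0. norm ((max 0 h)\<^sup>2 / h) \<le> \<bar>h\<bar>"
      by (intro always_eventually) (auto simp: max_def power2_eq_square)
    show "((\<lambda>h::real. \<bar>h\<bar>) \<longlongrightarrow> 0) (at 0)"
      by (intro tendsto_eq_intros) auto
  qed
  then show ?thesis
    using True by (simp add: DERIV_def)
next
  case False
  then consider "t < 0" | "t > 0" by linarith
  then show ?thesis
  proof cases
    case 1
    have "((\<lambda>t::real. (max 0 t)\<^sup>2) has_real_derivative 0) (at t)"
    proof (rule has_field_derivative_transform_within_open[where S="{..<0}" and f="\<lambda>_. 0"])
    qed (use 1 in auto)
    with 1 show ?thesis by simp
  next
    case 2
    have "((\<lambda>t::real. (max 0 t)\<^sup>2) has_real_derivative 2 * t) (at t)"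
    proof (rule has_field_derivative_transform_within_open[where S="{0<..}" and f="\<lambda>t. t\<^sup>2"])
      show "((\<lambda>t::real. t\<^sup>2) has_real_derivative 2 * t) (at t)"
        by (auto intro!: derivative_eq_intros)
    qed (use 2 in auto)
    with 2 show ?thesis by simp
  qed
qed

lemma bump_deriv:
  "(bump a b has_real_derivative 2 * max 0 ((x - a) * (b - x)) * (a + b - 2 * x)) (at x)"
proof -
  have "((\<lambda>x. (x - a) * (b - x)) has_real_derivative (a + b - 2 * x)) (at x)"
    by (auto intro!: derivative_eq_intros simp: algebra_simps)
  from DERIV_chain2[OF max0_square_deriv this] show ?thesis
    by (simp add: bump_def[abs_def])
qed

lemma bump_nonneg: "0 \<le> bump a b x"
  by (simp add: bump_def)

lemma bump_continuous: "continuous_on UNIV (bump a b)"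
  using bump_deriv by (rule DERIV_continuous_on)

lemma bump_outside: "x \<le> a \<or> b \<le> x \<Longrightarrow> a \<le> b \<Longrightarrow> bump a b x = 0"
  by (auto simp: bump_def max_absorb1 mult_nonpos_nonneg mult_nonneg_nonpos)

lemma test_intervalI:
  assumes "\<phi> C1_differentiable_on UNIV" "\<And>x. x \<notin> {a..b} \<Longrightarrow> \<phi> x = 0" "0 < a" "b < 1"
  shows "test_interval \<phi>"
proof -
  have "{x. \<phi> x \<noteq> 0} \<subseteq> {a..b}" using assms(2) by blast
  then have "closure {x. \<phi> x \<noteq> 0} \<subseteq> {a..b}" by (rule closure_minimal) simp
  with assms show ?thesis by (auto simp: test_interval_def)
qed

lemma test_interval_bump:
  assumes "0 < a" "a \<le> b" "b < 1" "0 \<le> c"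
  shows "test_interval (\<lambda>x. c * bump a b x / (1 + c * bump a b x))"
    and "test_interval (bump a b)"
proof -
  let ?D = "\<lambda>x. 2 * max 0 ((x - a) * (b - x)) * (a + b - 2 * x)"
  have pos: "0 < 1 + c * bump a b x" for x
    using assms(4) bump_nonneg[of a b x] by (simp add: add_pos_nonneg)
  have d: "((\<lambda>x. c * bump a b x / (1 + c * bump a b x)) has_real_derivative
      c * ?D x / (1 + c * bump a b x)\<^sup>2) (at x)" for x
    using pos[of x]
    by (auto intro!: derivative_eq_intros bump_deriv simp: field_simps power2_eq_square)
  have "continuous_on UNIV (\<lambda>x. c * ?D x / (1 + c * bump a b x)\<^sup>2)"
    using pos by (intro continuous_intros bump_continuous) (auto simp: less_imp_neq[THEN not_sym])
  from C1I[OF d this] show "test_interval (\<lambda>x. c * bump a b x / (1 + c * bump a b x))"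
    by (rule test_intervalI[where a = a and b = b]) (use assms bump_outside in auto)
  have "continuous_on UNIV ?D" by (intro continuous_intros)
  from C1I[OF bump_deriv this] show "test_interval (bump a b)"
    by (rule test_intervalI[where a = a and b = b]) (use assms bump_outside in auto)
qed

lemma fundamental_lemma:
  assumes f: "f \<in> L2" and 0: "\<And>\<phi>. test_interval \<phi> \<Longrightarrow> (LINT x|I01. f x * \<phi> x) = 0"
  shows "AE x in I01. f x = 0"
proof -
  let ?f = "\<lambda>x. indicator {0<..<1} x * f x"
  have intf: "integrable lebesgue ?f"
    using L2_integrable[OF f] by (simp add: integrable_restrict_space)
  have mf: "?f \<in> borel_measurable lebesgue"
    using intf by (rule borel_measurable_integrable)
  obtain g where g: "g \<in> borel_measurable lborel" "AE x in lborel. ?f x = g x"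
    using completion_ex_borel_measurable_real[OF mf] by auto
  have fg: "AE x in lebesgue. ?f x = g x"
    using g(2) by (rule AE_completion)
  have mg: "g \<in> borel_measurable lebesgue"
    using g(1) by (rule measurable_completion)
  have "integrable lebesgue g"
    using intf mg fg by (rule integrable_cong_AE_imp)
  then have intg: "integrable lborel g"
    using g(1) by (simp add: integrable_completion)
  have key: "(LINT x|lborel. indicator {a<..<b} x * g x) = 0" for a b
  proof (cases "max a 0 < min b 1")
    case False
    have "AE x in lborel. indicator {a<..<b} x * g x = 0"
      using g(2) by eventually_elim (use False in \<open>auto simp: indicator_def split: if_splits\<close>)
    then show ?thesis by (rule integral_eq_zero_AE)
  next
    case True
    define a' b' where "a' = max a 0" and "b' = min b 1"
    have ab: "0 \<le> a'" "a' < b'" "b' \<le> 1" using True by (auto simp: a'_def b'_def)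
    define r where "r n = (b' - a') / (real n + 3)" for n
    have r: "0 < r n" "2 * r n < b' - a'" for n
    proof -
      have d: "0 < b' - a'" using ab by simp
      then show "0 < r n" by (simp add: r_def add_nonneg_pos)
      have "2 / (real n + 3) < 1" by simp
      from mult_strict_right_mono[OF this d] show "2 * r n < b' - a'" by (simp add: r_def)
    qed
    have rlim: "r \<longlonglongrightarrow> 0" unfolding r_def
      by (intro tendsto_divide_0[OF tendsto_const] filterlim_at_top_imp_at_infinity
          filterlim_tendsto_add_at_top[OF tendsto_const, of _ _ 3, simplified add.commute]
          filterlim_real_sequentially)
    define \<phi> where "\<phi> n x = real n * bump (a' + r n) (b' - r n) x
        / (1 + real n * bump (a' + r n) (b' - r n) x)" for n x
    have test: "test_interval (\<phi> n)" for n
      unfolding \<phi>_def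
      by (rule test_interval_bump) (use ab r[of n] in linarith)+
    have bnd: "\<bar>\<phi> n x\<bar> \<le> 1" for n x
    proof -
      define t where "t = real n * bump (a' + r n) (b' - r n) x"
      have "0 \<le> t" by (simp add: t_def bump_nonneg)
      then show ?thesis by (simp add: \<phi>_def t_def[symmetric])
    qed
    have lim: "(\<lambda>n. \<phi> n x) \<longlonglongrightarrow> indicator {a'<..<b'} x" for x
    proof (cases "x \<in> {a'<..<b'}")
      case False
      have "\<phi> n x = 0" for n
      proof -
        have "x \<le> a' + r n \<or> b' - r n \<le> x" using False r[of n] by auto
        then have "bump (a' + r n) (b' - r n) x = 0"
          using r[of n] by (intro bump_outside) auto
        then show ?thesis by (simp add: \<phi>_def)
      qed
      with False show ?thesis by simp
    next
      case x: True
      define B where "B n = bump (a' + r n) (b' - r n) x" for n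
      have "B \<longlonglongrightarrow> (max 0 ((x - (a' + 0)) * ((b' - 0) - x)))\<^sup>2"
        unfolding B_def bump_def by (intro tendsto_intros rlim)
      moreover have "0 < (max 0 ((x - (a' + 0)) * ((b' - 0) - x)))\<^sup>2"
        using x by (simp add: max_def)
      ultimately have "filterlim (\<lambda>n. B n * real n) at_top sequentially"
        using filterlim_tendsto_pos_mult_at_top filterlim_real_sequentially by blast
      then have "filterlim (\<lambda>n. 1 + B n * real n) at_top sequentially"
        by (intro filterlim_tendsto_add_at_top[OF tendsto_const])
      then have "(\<lambda>n. 1 / (1 + B n * real n)) \<longlonglongrightarrow> 0"
        by (intro tendsto_divide_0[OF tendsto_const] filterlim_at_top_imp_at_infinity)
      then have "(\<lambda>n. 1 - 1 / (1 + B n * real n)) \<longlonglongrightarrow> 1 - 0"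
        by (intro tendsto_intros)
      moreover have "\<phi> n x = 1 - 1 / (1 + B n * real n)" for n
      proof -
        have "0 < 1 + B n * real n"
          using bump_nonneg[of "a' + r n" "b' - r n" x] by (simp add: B_def add_pos_nonneg)
        then show ?thesis by (simp add: \<phi>_def B_def[symmetric] field_simps)
      qed
      ultimately show ?thesis using x by simp
    qed
    have m\<phi>: "\<phi> n \<in> borel_measurable borel" for n
      using C1_UNIV(3)[OF test_interval_C1[OF test[of n]]]
      by (rule borel_measurable_continuous_onI)
    have z: "(LINT x|lborel. \<phi> n x * g x) = 0" for n
    proof -
      have "(LINT x|lborel. \<phi> n x * g x) = (LINT x|lebesgue. \<phi> n x * g x)"
        using m\<phi>[of n] g(1) by (intro integral_completion[symmetric]) auto
      also have "\<dots> = (LINT x|lebesgue. \<phi> n x * ?f x)"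
      proof (rule integral_cong_AE)
        have mL: "\<phi> n \<in> borel_measurable lebesgue"
          using m\<phi>[of n] by (intro measurable_completion) simp
        show "(\<lambda>x. \<phi> n x * g x) \<in> borel_measurable lebesgue"
          using mL mg by (rule borel_measurable_times)
        show "(\<lambda>x. \<phi> n x * ?f x) \<in> borel_measurable lebesgue"
          using mL mf by (rule borel_measurable_times)
        show "AE x in lebesgue. \<phi> n x * g x = \<phi> n x * ?f x"
          using fg by eventually_elim simp
      qed
      also have "\<dots> = (LINT x|I01. f x * \<phi> n x)"
        by (simp add: integral_restrict_space mult_ac)
      finally show ?thesis using 0[OF test] by simp
    qed
    have "(\<lambda>n. LINT x|lborel. \<phi> n x * g x) \<longlonglongrightarrow> (LINT x|lborel. indicator {a'<..<b'} x * g x)"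
    proof (rule integral_dominated_convergence[where w = "\<lambda>x. \<bar>g x\<bar>"])
      show "AE x in lborel. (\<lambda>n. \<phi> n x * g x) \<longlonglongrightarrow> indicator {a'<..<b'} x * g x"
        by (intro AE_I2 tendsto_intros lim)
      show "AE x in lborel. norm (\<phi> n x * g x) \<le> \<bar>g x\<bar>" for n
        using bnd by (intro AE_I2) (auto simp: abs_mult intro!: mult_left_le_one_le)
    qed (use m\<phi> g(1) intg in auto)
    then have "(LINT x|lborel. indicator {a'<..<b'} x * g x) = 0"
      by (simp add: z LIMSEQ_const_iff)
    moreover have "(LINT x|lborel. indicator {a<..<b} x * g x)
        = (LINT x|lborel. indicator {a'<..<b'} x * g x)"
    proof (rule integral_cong_AE)
      show "AE x in lborel. indicator {a<..<b} x * g x = indicator {a'<..<b'} x * g x"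
        using g(2) by eventually_elim
          (auto simp: a'_def b'_def indicator_def split: if_splits)
    qed (use g(1) in auto)
    ultimately show ?thesis by simp
  qed
  have "(LINT x|lborel. g x) = (LINT x|lborel. indicator {-1<..<2} x * g x)"
  proof (rule integral_cong_AE)
    show "AE x in lborel. g x = indicator {-1<..<2} x * g x"
      using g(2)
    proof eventually_elim
      case (elim x)
      show ?case
        by (cases "0 < x \<and> x < 1") (use elim in auto)
    qed
  qed (use g(1) in auto)
  then have tot: "(LINT x|lborel. g x) = 0" by (simp add: key)
  let ?G = "range (\<lambda>(a, b). {a<..<b::real})"
  have borel_G: "(borel :: real measure) = sigma UNIV ?G"
    using borel_eq_box[where 'a = real] by (simp add: box_real)
  have si: "set_integrable lborel A g" if "A \<in> sets borel" for A
    unfolding set_integrable_def using that intg by (intro integrable_mult_indicator) auto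
  have all: "set_lebesgue_integral lborel A g = 0" if "A \<in> sets borel" for A
  proof -
    have "Int_stable ?G"
      by (auto simp: Int_stable_def)
    moreover have "?G \<subseteq> Pow UNIV" by simp
    moreover have "A \<in> sigma_sets UNIV ?G"
      using that by (simp add: borel_G)
    ultimately show ?thesis
    proof (induction rule: sigma_sets_induct_disjoint)
      case (basic A)
      then show ?case using key by (auto simp: set_lebesgue_integral_def)
    next
      case empty
      show ?case by (simp add: set_lebesgue_integral_def)
    next
      case (compl A)
      then have A: "A \<in> sets borel" by (simp add: borel_G)
      have "set_lebesgue_integral lborel (A \<union> (UNIV - A)) g
          = set_lebesgue_integral lborel A g + set_lebesgue_integral lborel (UNIV - A) g"
        using A by (intro set_integral_Un si) auto
      then show ?case using compl tot by (simp add: set_lebesgue_integral_def)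
    next
      case (union A)
      then have A: "A i \<in> sets borel" for i by (auto simp: borel_G)
      have "set_lebesgue_integral lborel (\<Union>i. A i) g = (\<Sum>i. set_lebesgue_integral lborel (A i) g)"
        using A union(1) by (intro lebesgue_integral_countable_add si)
          (auto simp: disjoint_family_on_def)
      then show ?case using union by simp
    qed
  qed
  have "AE x in lborel. g x = 0"
    using intg by (rule sigma_finite_measure.density_zero[OF lborel.sigma_finite_measure_axioms]) (use all in auto)
  then have "AE x in lebesgue. g x = 0" by (rule AE_completion)
  with fg have "AE x in lebesgue. x \<in> {0<..<1} \<longrightarrow> f x = 0"
    by eventually_elim auto
  then show ?thesis by (simp add: AE_restrict_space_iff)
qed


lemma weak_deriv_const:
  assumes u: "u \<in> L2" and 0: "weak_deriv_interval u (\<lambda>_. 0)"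
  shows "\<exists>c. AE x in I01. u x = c"
proof -
  define B where "B = bump (1/4) (3/4)"
  have testB: "test_interval B" unfolding B_def by (rule test_interval_bump) auto
  have B2: "B \<in> L2" using C1_L2 test_interval_C1 testB by blast
  define \<beta> where "\<beta> = (LINT x|I01. B x)"
  have "\<beta> \<noteq> 0"
  proof
    assume "\<beta> = 0"
    then have "AE x in I01. B x = 0"
      using integral_nonneg_eq_0_iff_AE[OF L2_integrable[OF B2]] bump_nonneg
      by (auto simp: B_def \<beta>_def)
    then have "AE x in lebesgue. x \<in> {0<..<1} \<longrightarrow> B x = 0"
      by (simp add: AE_restrict_space_iff)
    then have "AE x in lebesgue. x \<notin> {1/4<..<3/4::real}"
      by eventually_elim (auto simp: B_def bump_def max_def split: if_splits)
    then have "{1/4<..<3/4::real} \<in> null_sets lebesgue"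
      by (subst AE_iff_null_sets) auto
    then have "negligible {1/4<..<3/4::real}" by (simp add: negligible_iff_null_sets)
    then show False using negligible_interval(2)[of "1/4::real" "3/4"] by (simp add: box_real)
  qed
  define c where "c = (LINT x|I01. u x * B x) / \<beta>"
  have "AE x in I01. u x - c = 0"
  proof (rule fundamental_lemma)
    show "(\<lambda>x. u x - c) \<in> L2" using L2_add[OF u L2_const[of "-c"]] by simp
    fix \<psi> assume test: "test_interval \<psi>"
    have \<psi>2: "\<psi> \<in> L2" using C1_L2 test_interval_C1 test by blast
    define k where "k = (LINT x|I01. \<psi> x) / \<beta>"
    define \<theta> where "\<theta> x = \<psi> x - k * B x" for x
    have \<theta>c: "continuous_on UNIV \<theta>"
      unfolding \<theta>_def
      by (intro continuous_intros C1_UNIV(3) test_interval_C1 test testB)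
    define K where "K = insert (1/2) (closure {x. \<psi> x \<noteq> 0} \<union> closure {x. B x \<noteq> 0})"
    have K01: "K \<subseteq> {0<..<1}" using test testB by (auto simp: K_def test_interval_def)
    then have "K \<subseteq> {0..1}" by auto
    then have "bounded K" by (rule bounded_subset[OF bounded_closed_interval])
    moreover have "closed K" unfolding K_def by (intro closed_insert closed_Un closed_closure)
    ultimately have K: "compact K" by (simp add: compact_eq_bounded_closed)
    have Kne: "K \<noteq> {}" by (simp add: K_def)
    obtain a where a: "a \<in> K" "\<And>x. x \<in> K \<Longrightarrow> a \<le> x" using compact_attains_inf[OF K Kne] by blast
    obtain b where b: "b \<in> K" "\<And>x. x \<in> K \<Longrightarrow> x \<le> b" using compact_attains_sup[OF K Kne] by blast
    have ab: "0 < a" "b < 1" "a \<le> b" using a b K01 by auto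
    have \<theta>0: "\<theta> x = 0" if "x \<notin> {a..b}" for x
    proof -
      have "x \<notin> K" using that a b by auto
      then have "x \<notin> {x. \<psi> x \<noteq> 0}" "x \<notin> {x. B x \<noteq> 0}"
        using closure_subset[of "{x. \<psi> x \<noteq> 0}"] closure_subset[of "{x. B x \<noteq> 0}"]
        unfolding K_def by auto
      then show ?thesis by (simp add: \<theta>_def)
    qed
    define \<phi> where "\<phi> x = integral {0..x} \<theta>" for x
    have ion: "\<theta> integrable_on {s..t}" for s t
      by (intro integrable_continuous_interval continuous_on_subset[OF \<theta>c]) auto
    have \<theta>2: "\<theta> \<in> L2" using \<theta>c by (rule L2_continuous)
    have "(LINT x|I01. \<theta> x) = 0"
      unfolding \<theta>_def using L2_integrable[OF \<psi>2] L2_integrable[OF B2] \<open>\<beta> \<noteq> 0\<close>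
      by (simp add: k_def \<beta>_def)
    then have tot: "integral {0..1} \<theta> = 0"
      using lebesgue_integral_eq_integral[OF L2_integrable[OF \<theta>2]]
        integral_open_interval_real[of 0 1 \<theta>] by simp
    have \<phi>0: "\<phi> x = 0" if "x < a" for x
    proof -
      have "integral {0..x} \<theta> = integral {0..x} (\<lambda>_. 0)"
        using that by (intro integral_cong \<theta>0) auto
      then show ?thesis by (simp add: \<phi>_def)
    qed
    have \<phi>1: "\<phi> x = 0" if "b < x" for x
    proof -
      have *: "integral {b..y} \<theta> = 0" for y
      proof -
        have "integral {b..y} \<theta> = integral {b..y} (\<lambda>_. 0)"
          by (rule integral_spike[where S = "{b}"]) (use \<theta>0 in auto)
        then show ?thesis by simp
      qed
      have "integral {0..b} \<theta> + integral {b..x} \<theta> = integral {0..x} \<theta>"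
        using that ab by (intro Henstock_Kurzweil_Integration.integral_combine ion) auto
      moreover have "integral {0..b} \<theta> + integral {b..1} \<theta> = integral {0..1} \<theta>"
        using that ab by (intro Henstock_Kurzweil_Integration.integral_combine ion) auto
      ultimately show ?thesis using tot by (simp add: \<phi>_def *)
    qed
    have d: "(\<phi> has_real_derivative \<theta> x) (at x)" for x
    proof (cases "x < a")
      case True
      have "(\<phi> has_real_derivative 0) (at x)"
        by (rule has_field_derivative_transform_within_open[where S = "{..<a}" and f = "\<lambda>_. 0"])
          (use True \<phi>0 in auto)
      then show ?thesis using True \<theta>0[of x] by simp
    next
      case False
      then have x: "0 < x" using ab by simp
      have "(\<phi> has_vector_derivative \<theta> x) (at x within {0..x+1})"
        unfolding \<phi>_def using x
        by (intro integral_has_vector_derivative continuous_on_subset[OF \<theta>c]) auto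
      then have "(\<phi> has_real_derivative \<theta> x) (at x within {0..x+1})"
        by (simp add: has_real_derivative_iff_has_vector_derivative)
      moreover have "at x within {0..x+1} = at x"
        using x by (intro at_within_interior) (simp add: interior_atLeastAtMost_real)
      ultimately show ?thesis by simp
    qed
    have d': "deriv \<phi> = \<theta>" using d by (auto intro: DERIV_imp_deriv)
    have "test_interval \<phi>"
      by (rule test_intervalI[OF C1I[OF d \<theta>c], of a b]) (use \<phi>0 \<phi>1 ab in force)+
    then have "(LINT x|I01. u x * \<theta> x) = 0"
      using 0[unfolded weak_deriv_interval_def, rule_format, of \<phi>] by (simp add: d')
    moreover have "(LINT x|I01. u x * \<theta> x) = (LINT x|I01. u x * \<psi> x - k * (u x * B x))"
      by (simp add: \<theta>_def algebra_simps)
    moreover have "\<dots> = (LINT x|I01. u x * \<psi> x) - k * (LINT x|I01. u x * B x)"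
      using L2_mult[OF u \<psi>2] L2_mult[OF u B2] by simp
    moreover have "k * (LINT x|I01. u x * B x) = c * (LINT x|I01. \<psi> x)"
      by (simp add: k_def c_def)
    moreover have "(LINT x|I01. (u x - c) * \<psi> x) = (LINT x|I01. u x * \<psi> x - c * \<psi> x)"
      by (simp add: algebra_simps)
    moreover have "\<dots> = (LINT x|I01. u x * \<psi> x) - c * (LINT x|I01. \<psi> x)"
      using L2_mult[OF u \<psi>2] L2_integrable[OF \<psi>2] by simp
    ultimately show "(LINT x|I01. (u x - c) * \<psi> x) = 0" by simp
  qed
  then show ?thesis by (intro exI[of _ c]) simp
qed


subsection \<open>Calculus of weak derivatives\<close>

lemma weak_deriv_unique:
  assumes "v \<in> L2" "w \<in> L2" "weak_deriv_interval u v" "weak_deriv_interval u w"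
  shows "AE x in I01. v x = w x"
proof -
  have "AE x in I01. v x - w x = 0"
  proof (rule fundamental_lemma)
    show "(\<lambda>x. v x - w x) \<in> L2"
      using L2_add[OF assms(1) L2_scale[OF assms(2), of "-1"]] by simp
    fix \<phi> assume t: "test_interval \<phi>"
    then have \<phi>: "\<phi> \<in> L2" using C1_L2 test_interval_C1 by blast
    have "(LINT x|I01. (v x - w x) * \<phi> x) = (LINT x|I01. v x * \<phi> x) - (LINT x|I01. w x * \<phi> x)"
      using L2_mult[OF assms(1) \<phi>] L2_mult[OF assms(2) \<phi>] by (simp add: left_diff_distrib)
    then show "(LINT x|I01. (v x - w x) * \<phi> x) = 0"
      using assms t by (simp add: weak_deriv_interval_def)
  qed
  then show ?thesis by simp
qed

lemma weak_deriv_add: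
  assumes "u \<in> L2" "v \<in> L2" "u' \<in> L2" "v' \<in> L2"
    "weak_deriv_interval u u'" "weak_deriv_interval v v'"
  shows "weak_deriv_interval (\<lambda>x. u x + v x) (\<lambda>x. u' x + v' x)"
  unfolding weak_deriv_interval_def
proof (intro allI impI)
  fix \<phi> assume t: "test_interval \<phi>"
  then have \<phi>: "\<phi> \<in> L2" "deriv \<phi> \<in> L2" using C1_L2 test_interval_C1 by blast+
  show "(LINT x|I01. (u x + v x) * deriv \<phi> x) = - (LINT x|I01. (u' x + v' x) * \<phi> x)"
    using assms t L2_mult[OF assms(1) \<phi>(2)] L2_mult[OF assms(2) \<phi>(2)]
      L2_mult[OF assms(3) \<phi>(1)] L2_mult[OF assms(4) \<phi>(1)]
    by (simp add: distrib_right weak_deriv_interval_def)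
qed

lemma weak_deriv_scale:
  assumes "weak_deriv_interval u v"
  shows "weak_deriv_interval (\<lambda>x. c * u x) (\<lambda>x. c * v x)"
  using assms by (simp add: weak_deriv_interval_def mult.assoc)

lemma weak_deriv_cong:
  assumes "u \<in> L2" "w \<in> L2" "AE x in I01. u x = w x"
  shows "weak_deriv_interval u v \<longleftrightarrow> weak_deriv_interval w v"
proof -
  have "(LINT x|I01. u x * deriv \<phi> x) = (LINT x|I01. w x * deriv \<phi> x)"
    if t: "test_interval \<phi>" for \<phi>
  proof (rule integral_cong_AE)
    have \<phi>: "deriv \<phi> \<in> L2" using C1_L2 test_interval_C1 t by blast
    show "(\<lambda>x. u x * deriv \<phi> x) \<in> borel_measurable I01"
      "(\<lambda>x. w x * deriv \<phi> x) \<in> borel_measurable I01"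
      using L2_mult[OF assms(1) \<phi>] L2_mult[OF assms(2) \<phi>] by auto
    show "AE x in I01. u x * deriv \<phi> x = w x * deriv \<phi> x"
      using assms(3) by eventually_elim simp
  qed
  then show ?thesis by (simp add: weak_deriv_interval_def)
qed

lemma H_per_ave_1_iff:
  "u \<in> H_per_ave (Suc 0) \<longleftrightarrow>
     u \<in> L2 \<and> wderiv u \<in> L2 \<and> weak_deriv_interval u (wderiv u) \<and> (LINT x|I01. u x) = 0"
proof -
  have "wderiv u \<in> L2 \<and> weak_deriv_interval u (wderiv u)"
    if "v \<in> L2" "weak_deriv_interval u v" for v
    unfolding wderiv_def by (rule someI[of _ v]) (use that in simp)
  then show ?thesis by (auto simp: H_per_ave_def)
qed

lemma H_per_ave_1I:
  assumes "u \<in> L2" "v \<in> L2" "weak_deriv_interval u v" "(LINT x|I01. u x) = 0"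
  shows "u \<in> H_per_ave (Suc 0)" "AE x in I01. wderiv u x = v x"
proof -
  have *: "wderiv u \<in> L2 \<and> weak_deriv_interval u (wderiv u)"
    unfolding wderiv_def by (rule someI[of _ v]) (use assms in simp)
  with assms show "u \<in> H_per_ave (Suc 0)" by (simp add: H_per_ave_1_iff)
  from * assms show "AE x in I01. wderiv u x = v x" by (intro weak_deriv_unique) auto
qed

lemma H_per_ave_1_add:
  assumes "u \<in> H_per_ave (Suc 0)" "v \<in> H_per_ave (Suc 0)"
  shows "(\<lambda>x. u x + v x) \<in> H_per_ave (Suc 0)"
    "AE x in I01. wderiv (\<lambda>x. u x + v x) x = wderiv u x + wderiv v x"
proof -
  have "(LINT x|I01. u x + v x) = 0"
    using assms by (simp add: H_per_ave_1_iff L2_integrable)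
  note * = H_per_ave_1I[OF L2_add L2_add weak_deriv_add this]
  show "(\<lambda>x. u x + v x) \<in> H_per_ave (Suc 0)"
    "AE x in I01. wderiv (\<lambda>x. u x + v x) x = wderiv u x + wderiv v x"
    using assms unfolding H_per_ave_1_iff[of u] H_per_ave_1_iff[of v] by (blast intro: *)+
qed

lemma H_per_ave_1_scale:
  assumes "u \<in> H_per_ave (Suc 0)"
  shows "(\<lambda>x. c * u x) \<in> H_per_ave (Suc 0)"
    "AE x in I01. wderiv (\<lambda>x. c * u x) x = c * wderiv u x"
proof -
  have "(LINT x|I01. c * u x) = 0"
    using assms by (simp add: H_per_ave_1_iff)
  note * = H_per_ave_1I[OF L2_scale L2_scale weak_deriv_scale this]
  show "(\<lambda>x. c * u x) \<in> H_per_ave (Suc 0)"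
    "AE x in I01. wderiv (\<lambda>x. c * u x) x = c * wderiv u x"
    using assms unfolding H_per_ave_1_iff[of u] by (blast intro: *)+
qed

lemma H_per_ave_1_zero: "(\<lambda>_. 0) \<in> H_per_ave (Suc 0)"
  by (rule H_per_ave_1I(1)[OF L2_const L2_const[of 0]]) (auto simp: weak_deriv_interval_def)

lemma H_per_ave_1_eq_zero:
  assumes u: "u \<in> H_per_ave (Suc 0)" and 0: "(LINT x|I01. wderiv u x * wderiv u x) = 0"
  shows "AE x in I01. u x = 0"
proof -
  have u': "u \<in> L2" "wderiv u \<in> L2" "weak_deriv_interval u (wderiv u)" "(LINT x|I01. u x) = 0"
    using u by (simp_all add: H_per_ave_1_iff)
  have z: "AE x in I01. wderiv u x = 0"
    using integral_nonneg_eq_0_iff_AE[OF L2_mult[OF u'(2) u'(2)]] 0 by simp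
  have "weak_deriv_interval u (\<lambda>_. 0)"
    unfolding weak_deriv_interval_def
  proof (intro allI impI)
    fix \<phi> assume t: "test_interval \<phi>"
    have "(LINT x|I01. wderiv u x * \<phi> x) = 0"
      by (rule integral_eq_zero_AE) (use z in \<open>auto elim: eventually_mono\<close>)
    with u'(3) t show "(LINT x|I01. u x * deriv \<phi> x) = - (LINT x|I01. 0 * \<phi> x)"
      by (simp add: weak_deriv_interval_def)
  qed
  then obtain c where c: "AE x in I01. u x = c" using weak_deriv_const u' by blast
  have "(LINT x|I01. u x) = (LINT x|I01. c)"
    using c u'(1) by (intro integral_cong_AE) (auto simp: L2_def)
  then have "c = 0" using u'(4) by (simp add: measure_restrict_space)
  with c show ?thesis by simp
qed


section \<open>The space \<open>H\<^sup>1\<close> of zero-mean functions, as a type\<close>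

text \<open>
  Elements are classes of functions modulo equality almost everywhere, and the inner product
  is \<open>\<integral>\<^sub>0\<^sup>1 u\<^sub>x v\<^sub>x dx\<close>. For \<open>k = 1\<close> there is no periodicity condition
  beyond \<open>u\<^sub>x \<in> L\<^sup>2\<close>.
\<close>

definition h1_rel :: "(real \<Rightarrow> real) \<Rightarrow> (real \<Rightarrow> real) \<Rightarrow> bool" where
  "h1_rel u v \<longleftrightarrow> u \<in> H_per_ave 1 \<and> v \<in> H_per_ave 1 \<and> (AE x in I01. u x = v x)"

lemma part_equivp_h1_rel: "part_equivp h1_rel"
proof (rule part_equivpI)
  show "\<exists>u. h1_rel u u"
    using H_per_ave_1_zero by (intro exI[of _ "\<lambda>_. 0"]) (simp add: h1_rel_def)
  show "symp h1_rel"
    by (auto simp: symp_def h1_rel_def elim: eventually_mono)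
  show "transp h1_rel"
    unfolding transp_def h1_rel_def by (auto elim: eventually_elim2)
qed

quotient_type h1 = "real \<Rightarrow> real" / partial: h1_rel
  by (rule part_equivp_h1_rel)

lemma h1_rel_weak_deriv:
  assumes "h1_rel u v"
  shows "weak_deriv_interval u w \<longleftrightarrow> weak_deriv_interval v w"
  using assms by (intro weak_deriv_cong) (auto simp: h1_rel_def H_per_ave_1_iff)

lemma h1_rel_wderiv:
  assumes "h1_rel u v"
  shows "wderiv u = wderiv v"
  using h1_rel_weak_deriv[OF assms] by (simp add: wderiv_def)

lift_definition h1_deriv :: "h1 \<Rightarrow> real \<Rightarrow> real" is wderiv
  by (rule h1_rel_wderiv)

instantiation h1 :: real_inner
begin

lift_definition zero_h1 :: h1 is "\<lambda>_. 0"
  by (simp add: h1_rel_def H_per_ave_1_zero)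

lift_definition plus_h1 :: "h1 \<Rightarrow> h1 \<Rightarrow> h1" is "\<lambda>u v x. u x + v x"
  unfolding h1_rel_def by (auto intro: H_per_ave_1_add elim: eventually_elim2)

lift_definition scaleR_h1 :: "real \<Rightarrow> h1 \<Rightarrow> h1" is "\<lambda>c u x. c * u x"
  unfolding h1_rel_def by (auto intro: H_per_ave_1_scale)

definition uminus_h1 :: "h1 \<Rightarrow> h1" where "- u = (-1) *\<^sub>R u" for u :: h1

definition minus_h1 :: "h1 \<Rightarrow> h1 \<Rightarrow> h1" where "u - v = u + - v" for u v :: h1

definition inner_h1 :: "h1 \<Rightarrow> h1 \<Rightarrow> real" where
  "inner u v = (LINT x|I01. h1_deriv u x * h1_deriv v x)"

definition norm_h1 :: "h1 \<Rightarrow> real" where "norm u = sqrt (inner u u)" for u :: h1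

definition sgn_h1 :: "h1 \<Rightarrow> h1" where "sgn u = inverse (norm u) *\<^sub>R u" for u :: h1

definition dist_h1 :: "h1 \<Rightarrow> h1 \<Rightarrow> real" where "dist u v = norm (u - v)" for u v :: h1

definition uniformity_h1 :: "(h1 \<times> h1) filter" where
  "uniformity_h1 = (INF e\<in>{0<..}. principal {(x, y). dist x y < e})"

definition open_h1 :: "h1 set \<Rightarrow> bool" where
  "open_h1 U \<longleftrightarrow> (\<forall>x\<in>U. eventually (\<lambda>(x', y). x' = x \<longrightarrow> y \<in> U) uniformity)"

lemma h1_deriv_L2: "h1_deriv u \<in> L2"
  by transfer (simp add: h1_rel_def H_per_ave_1_iff)

lemma h1_deriv_add: "AE x in I01. h1_deriv (u + v) x = h1_deriv u x + h1_deriv v x"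
  by transfer (simp add: h1_rel_def H_per_ave_1_add)

lemma h1_deriv_scale: "AE x in I01. h1_deriv (c *\<^sub>R u) x = c * h1_deriv u x"
  by transfer (simp add: h1_rel_def H_per_ave_1_scale)

instance
proof
  fix u v w :: h1 and a b :: real
  show "u + v + w = u + (v + w)"
    by transfer (auto simp: h1_rel_def intro!: H_per_ave_1_add)
  show "u + v = v + u"
    by transfer (auto simp: h1_rel_def intro!: H_per_ave_1_add)
  show z: "0 + u = u" for u :: h1
    by transfer (auto simp: h1_rel_def)
  have s: "(a + b) *\<^sub>R u = a *\<^sub>R u + b *\<^sub>R u" for a b and u :: h1
    by transfer (auto simp: h1_rel_def distrib_right intro!: H_per_ave_1_add H_per_ave_1_scale)
  then show "(a + b) *\<^sub>R u = a *\<^sub>R u + b *\<^sub>R u" .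
  have s0: "0 *\<^sub>R u = 0" for u :: h1
    by transfer (auto simp: h1_rel_def H_per_ave_1_zero)
  show s1: "1 *\<^sub>R u = u" for u :: h1
    by transfer (auto simp: h1_rel_def)
  show "- u + u = 0"
    using s[of "-1" 1 u] by (simp add: uminus_h1_def s0 s1)
  show "u - v = u + - v" by (simp add: minus_h1_def)
  show "a *\<^sub>R (u + v) = a *\<^sub>R u + a *\<^sub>R v"
    by transfer (auto simp: h1_rel_def distrib_left intro!: H_per_ave_1_add H_per_ave_1_scale)
  show "a *\<^sub>R b *\<^sub>R u = (a * b) *\<^sub>R u"
    by transfer (auto simp: h1_rel_def mult.assoc intro!: H_per_ave_1_scale)
  show "dist u v = norm (u - v)" by (simp add: dist_h1_def)
  show "sgn u = inverse (norm u) *\<^sub>R u" by (simp add: sgn_h1_def)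
  show "inner u v = inner v u" by (simp add: inner_h1_def mult.commute)
  have d [measurable]: "h1_deriv u \<in> borel_measurable I01" for u
    using h1_deriv_L2[of u] by (simp add: L2_def)
  show "inner (u + v) w = inner u w + inner v w"
  proof -
    have "inner (u + v) w
        = (LINT x|I01. h1_deriv u x * h1_deriv w x + h1_deriv v x * h1_deriv w x)"
      unfolding inner_h1_def
    proof (rule integral_cong_AE)
      show "AE x in I01. h1_deriv (u + v) x * h1_deriv w x
          = h1_deriv u x * h1_deriv w x + h1_deriv v x * h1_deriv w x"
        using h1_deriv_add[of u v] by eventually_elim (simp add: distrib_right)
    qed auto
    then show ?thesis
      by (simp add: inner_h1_def L2_mult h1_deriv_L2)
  qed
  show "inner (a *\<^sub>R u) v = a * inner u v"
  proof -
    have "inner (a *\<^sub>R u) v = (LINT x|I01. a * (h1_deriv u x * h1_deriv v x))"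
      unfolding inner_h1_def
    proof (rule integral_cong_AE)
      show "AE x in I01. h1_deriv (a *\<^sub>R u) x * h1_deriv v x
          = a * (h1_deriv u x * h1_deriv v x)"
        using h1_deriv_scale[of a u] by eventually_elim simp
    qed auto
    then show ?thesis by (simp add: inner_h1_def)
  qed
  show "0 \<le> inner u u" by (simp add: inner_h1_def)
  show "inner u u = 0 \<longleftrightarrow> u = 0"
  proof
    assume "inner u u = 0"
    then show "u = 0" unfolding inner_h1_def
      by transfer (auto simp: h1_rel_def H_per_ave_1_zero H_per_ave_1_eq_zero)
  next
    assume "u = 0"
    moreover have "AE x in I01. h1_deriv (0 *\<^sub>R u) x = 0"
      using h1_deriv_scale[of 0 u] by simp
    ultimately show "inner u u = 0"
      unfolding inner_h1_def s0
      by (intro integral_eq_zero_AE) (auto elim: eventually_mono)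
  qed
  show "norm u = sqrt (inner u u)" by (simp add: norm_h1_def)
qed (rule uniformity_h1_def open_h1_def)+

end

lift_definition h1_deriv2 :: "h1 \<Rightarrow> real \<Rightarrow> real" is "\<lambda>u. wderiv (wderiv u)"
proof -
  fix u v assume "h1_rel u v"
  then have "wderiv u = wderiv v" by (rule h1_rel_wderiv)
  then show "wderiv (wderiv u) = wderiv (wderiv v)" by (rule arg_cong)
qed

lift_definition in_H2_per_ave :: "h1 \<Rightarrow> bool" is "\<lambda>u. u \<in> H_per_ave 2"
proof -
  fix u v assume r: "h1_rel u v"
  have L: "u \<in> L2" "v \<in> L2" "(LINT x|I01. u x) = 0" "(LINT x|I01. v x) = 0"
    using r by (auto simp: h1_rel_def H_per_ave_1_iff)
  have "H_interval 2 = {u \<in> L2. \<exists>v \<in> H_interval 1. weak_deriv_interval u v}"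
    by (simp add: numeral_2_eq_2)
  then show "(u \<in> H_per_ave 2) = (v \<in> H_per_ave 2)"
    unfolding H_per_ave_def using L h1_rel_weak_deriv[OF r] h1_rel_wderiv[OF r] by simp
qed


section \<open>The spaces \<open>X\<close> and \<open>Y\<close>\<close>

text \<open>
  The library's inner product on the product type \<open>h1 \<times> real\<close> is exactly that of \<open>X\<close>.
  The space \<open>Y\<close> is a subset of \<open>X\<close> carrying its own, stronger inner product.
\<close>

type_synonym X = "h1 \<times> real"

definition Y :: "X set" where
  "Y = {u. in_H2_per_ave u} \<times> UNIV"

definition inner_Y :: "X \<Rightarrow> X \<Rightarrow> real" where
  "inner_Y p q =
     (LINT x|I01. h1_deriv (fst p) x * h1_deriv (fst q) x)
     + (LINT x|I01. h1_deriv2 (fst p) x * h1_deriv2 (fst q) x)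
     + snd p * snd q"

definition norm_Y :: "X \<Rightarrow> real" where
  "norm_Y p = sqrt (inner_Y p p)"

definition nbhd_Y :: "X set \<Rightarrow> X \<Rightarrow> bool" where
  "nbhd_Y U p \<longleftrightarrow> p \<in> Y \<and> U \<subseteq> Y \<and> (\<exists>r>0. {q \<in> Y. norm_Y (q - p) < r} \<subseteq> U)"


section \<open>The energy and its gradient\<close>

definition real_analytic :: "(real \<Rightarrow> real) \<Rightarrow> bool" where
  "real_analytic f \<longleftrightarrow>
     (\<forall>a. \<exists>r>0. \<exists>c :: nat \<Rightarrow> real. \<forall>x. \<bar>x - a\<bar> < r \<longrightarrow> (\<lambda>n. c n * (x - a) ^ n) sums f x)"

definition gradient :: "('a::real_inner \<Rightarrow> real) \<Rightarrow> 'a \<Rightarrow> 'a" where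
  "gradient F p = (THE D. GDERIV F p :> D)"

definition critical_point :: "('a::real_inner \<Rightarrow> real) \<Rightarrow> 'a \<Rightarrow> bool" where
  "critical_point F p \<longleftrightarrow> GDERIV F p :> 0"

definition curve_length :: "h1 \<Rightarrow> real" where
  "curve_length u = (LINT x|I01. sqrt (1 + \<bar>h1_deriv u x\<bar>\<^sup>2))"

definition energy :: "(real \<Rightarrow> real) \<Rightarrow> X \<Rightarrow> real" where
  "energy \<sigma> p = \<sigma> (snd p) * curve_length (fst p)"

definition slope_primitive :: "h1 \<Rightarrow> real \<Rightarrow> real" where
  "slope_primitive u x =
     (LINT y|lebesgue_on {0<..<x}. h1_deriv u y / sqrt (1 + (h1_deriv u y)\<^sup>2))"

text \<open>The first component of the gradient of the energy, as a function on \<open>(0,1)\<close>.\<close>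

definition gradient_fun :: "(real \<Rightarrow> real) \<Rightarrow> h1 \<Rightarrow> real \<Rightarrow> real \<Rightarrow> real" where
  "gradient_fun \<sigma> u \<alpha> x = \<sigma> \<alpha> * (slope_primitive u x - (LINT z|I01. slope_primitive u z))"

end

theory Submission
  imports Defs
begin

text \<open>
  The first component of the gradient has derivative \<open>\<sigma>(\<alpha>) u\<^sub>x / sqrt (1 + u\<^sub>x\<^sup>2)\<close>, so a critical
  point has \<open>u = 0\<close> and \<open>\<sigma>' = 0\<close>, and no infinite-dimensional reduction is needed. Near such
  a point the energy difference is at most a multiple of \<open>\<integral> u\<^sub>x\<^sup>2\<close> plus
  \<open>\<bar>\<sigma>(\<alpha>) - \<sigma>(\<alpha>\<^sub>0)\<bar>\<close>, where \<open>\<alpha>\<^sub>0\<close> is the critical parameter. Smallness in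
  \<open>Y\<close> gives \<open>\<bar>u\<^sub>x\<bar> \<le> 1\<close>, so the first term is controlled by the square of the first
  component of the gradient; the second is controlled by \<open>\<sigma>'(\<alpha>)\<close> through the one-variable
  Lojasiewicz inequality for \<open>\<sigma>\<close>, which supplies \<open>\<theta>\<close>.
\<close>

section \<open>Indefinite integrals\<close>

text \<open>The left-hand side is a norm of \<open>Y\<close> only if the gradient lies in
  \<open>Y\<close>, so \<open>u\<^sub>x / sqrt (1 + u\<^sub>x\<^sup>2)\<close> must again be
  periodic with a square integrable weak derivative. Functions are known only up to null sets, so
  neither end-point values nor a chain rule are at hand. Both come from an absolutely continuous
  representative of \<open>u\<^sub>x\<close>; \<open>indef_integral A a\<close> encodes absolute
  continuity of \<open>A\<close> as the fundamental theorem of calculus with density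
  \<open>a\<close>. A ball of \<open>X\<close> would not do for this argument: there
  \<open>u\<^sub>x\<close> may be huge on a tiny set, and the bounded integrand of the gradient does
  not see its size. The lower bound itself keeps only the \<open>X\<close>-part of the gradient
  norm.\<close>

definition indef_integral :: "(real \<Rightarrow> real) \<Rightarrow> (real \<Rightarrow> real) \<Rightarrow> bool" where
  "indef_integral A a \<longleftrightarrow>
     a absolutely_integrable_on {0..1} \<and> (\<forall>x\<in>{0..1}. A x - A 0 = integral {0..x} a)"

lemma indef_integral_subinterval:
  assumes "indef_integral A a" "0 \<le> x" "y \<le> 1"
  shows "a absolutely_integrable_on {x..y}"
  using assms by (auto simp: indef_integral_def intro: absolutely_integrable_on_subinterval)

lemma indef_integral_diff:
  assumes "indef_integral A a" "0 \<le> x" "x \<le> y" "y \<le> 1"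
  shows "A y - A x = integral {x..y} a"
proof -
  have "a integrable_on {0..y}"
    using indef_integral_subinterval[OF assms(1), of 0 y] assms
    by (auto simp: set_lebesgue_integral_eq_integral)
  from Henstock_Kurzweil_Integration.integral_combine[OF assms(2,3) this]
  have "integral {0..x} a + integral {x..y} a = integral {0..y} a" .
  moreover have "A x - A 0 = integral {0..x} a" "A y - A 0 = integral {0..y} a"
    using assms by (auto simp: indef_integral_def)
  ultimately show ?thesis by linarith
qed

lemma indef_integral_continuous:
  assumes "indef_integral A a"
  shows "continuous_on {0..1} A"
proof -
  have "a integrable_on {0..1}"
    using indef_integral_subinterval[OF assms, of 0 1] by (auto simp: set_lebesgue_integral_eq_integral)
  then have "continuous_on {0..1} (\<lambda>x. A 0 + integral {0..x} a)"
    by (intro continuous_intros indefinite_integral_continuous_1)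
  then show ?thesis
  proof (rule continuous_on_eq)
    fix x :: real assume "x \<in> {0..1}"
    then show "A 0 + integral {0..x} a = A x" using indef_integral_diff[OF assms, of 0 x] by simp
  qed
qed

lemma absolutely_integrable_continuous_times:
  fixes a g :: "real \<Rightarrow> real"
  assumes "continuous_on {x..y} g" "a absolutely_integrable_on {x..y}"
  shows "(\<lambda>t. g t * a t) absolutely_integrable_on {x..y}"
  using assms
  by (intro absolutely_integrable_bounded_measurable_product_real)
    (auto simp: continuous_imp_measurable_on_sets_lebesgue compact_imp_bounded compact_continuous_image)

text \<open>No differentiability almost everywhere enters. On a short interval the mean value
  theorem gives the increment of \<open>f (A x)\<close> as \<open>f' \<xi>\<close> times the
  integral of \<open>a\<close>, and uniform continuity puts \<open>f' \<xi>\<close> within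
  \<open>e\<close> of every \<open>f' (A t)\<close>, so the error is at most \<open>e\<close> times
  the integral of \<open>\<bar>a\<bar>\<close>. This bound is additive over adjacent intervals,
  hence bisection carries it to \<open>{0..z}\<close>, and \<open>e\<close> is arbitrary.\<close>

lemma indef_integral_chain:
  assumes A: "indef_integral A a"
    and f: "\<And>x. (f has_real_derivative f' x) (at x)" "continuous_on UNIV f'"
  shows "indef_integral (\<lambda>x. f (A x)) (\<lambda>x. f' (A x) * a x)"
proof -
  define b where "b x = f' (A x) * a x" for x
  have cA: "continuous_on {0..1} A" using A by (rule indef_integral_continuous)
  have cfA: "continuous_on {0..1} (\<lambda>x. f' (A x))"
    by (rule continuous_on_compose2[OF f(2) cA]) auto
  have sub: "a absolutely_integrable_on {x..y}" if "0 \<le> x" "y \<le> 1" for x y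
    using A that by (rule indef_integral_subinterval)
  have bint: "b absolutely_integrable_on {x..y}" if "0 \<le> x" "y \<le> 1" for x y
    unfolding b_def using that
    by (intro absolutely_integrable_continuous_times sub continuous_on_subset[OF cfA]) auto
  have bi: "b integrable_on {x..y}" and ai: "a integrable_on {x..y}"
    and an: "(\<lambda>t. \<bar>a t\<bar>) integrable_on {x..y}" if "0 \<le> x" "y \<le> 1" for x y
    using bint[OF that] sub[OF that] by (auto simp: absolutely_integrable_on_def)
  have combine: "integral {x..y} g + integral {y..z} g = integral {x..z} g"
    if "g integrable_on {x..z}" "x \<le> y" "y \<le> z" for g :: "real \<Rightarrow> real" and x y z
    using that by (intro Henstock_Kurzweil_Integration.integral_combine)
  obtain B where B: "\<And>x. x \<in> {0..1} \<Longrightarrow> \<bar>A x\<bar> \<le> B"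
    using compact_imp_bounded[OF compact_continuous_image[OF cA]]
    by (force simp: bounded_iff)
  have key: "f (A z) - f (A 0) = integral {0..z} b" if z: "0 \<le> z" "z \<le> 1" for z
  proof -
    have "\<bar>f (A z) - f (A 0) - integral {0..z} b\<bar> \<le> e * integral {0..z} (\<lambda>t. \<bar>a t\<bar>)"
      if "e > 0" for e
    proof -
      have "uniformly_continuous_on {-B..B} f'"
        by (intro compact_uniformly_continuous continuous_on_subset[OF f(2)]) auto
      then obtain d where d: "d > 0"
        "\<And>p q. p \<in> {-B..B} \<Longrightarrow> q \<in> {-B..B} \<Longrightarrow> dist q p < d \<Longrightarrow> dist (f' q) (f' p) < e"
        using \<open>e > 0\<close> by (metis uniformly_continuous_on_def)
      have "uniformly_continuous_on {0..1} A"
        by (intro compact_uniformly_continuous cA) auto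
      then obtain r where r: "r > 0"
        "\<And>p q. p \<in> {0..1} \<Longrightarrow> q \<in> {0..1} \<Longrightarrow> dist q p < r \<Longrightarrow> dist (A q) (A p) < d"
        using \<open>d > 0\<close> by (metis uniformly_continuous_on_def)
      have loc: "\<bar>f (A y) - f (A x) - integral {x..y} b\<bar> \<le> e * integral {x..y} (\<lambda>t. \<bar>a t\<bar>)"
        if xy: "0 \<le> x" "x \<le> y" "y \<le> 1" "y - x < r" for x y
      proof -
        obtain \<xi> where \<xi>: "f (A y) - f (A x) = f' \<xi> * (A y - A x)"
          "min (A x) (A y) \<le> \<xi>" "\<xi> \<le> max (A x) (A y)"
        proof (cases "A x = A y")
          case True
          then show ?thesis using that[of "A x"] by simp
        next
          case False
          then consider "A x < A y" | "A y < A x" by linarith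
          then show ?thesis
          proof cases
            case 1
            from MVT2[OF this f(1)] obtain \<xi> where
              "A x < \<xi>" "\<xi> < A y" "f (A y) - f (A x) = (A y - A x) * f' \<xi>" by blast
            then show ?thesis by (intro that[of \<xi>]) (auto simp: mult.commute)
          next
            case 2
            from MVT2[OF this f(1)] obtain \<xi> where
              "A y < \<xi>" "\<xi> < A x" "f (A x) - f (A y) = (A x - A y) * f' \<xi>" by blast
            then show ?thesis by (intro that[of \<xi>]) (auto simp: algebra_simps)
          qed
        qed
        have est: "\<bar>f' \<xi> - f' (A t)\<bar> \<le> e" if t: "t \<in> {x..y}" for t
        proof -
          have "dist (A x) (A t) < d" "dist (A y) (A t) < d"
            using t xy by (intro r(2); force simp: dist_real_def)+
          then have "dist \<xi> (A t) < d"
            using \<xi>(2,3) by (auto simp: dist_real_def min_def max_def split: if_splits)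
          moreover have "A t \<in> {-B..B}" "A x \<in> {-B..B}" "A y \<in> {-B..B}"
            using B[of t] B[of x] B[of y] t xy by auto
          moreover have "\<xi> \<in> {-B..B}"
            using \<open>A x \<in> {-B..B}\<close> \<open>A y \<in> {-B..B}\<close> \<xi>(2,3) by (auto simp: min_def max_def split: if_splits)
          ultimately show ?thesis using d(2)[of "A t" \<xi>] by (simp add: dist_real_def)
        qed
        have "f (A y) - f (A x) - integral {x..y} b = integral {x..y} (\<lambda>t. f' \<xi> * a t - b t)"
          using xy \<xi>(1) indef_integral_diff[OF A, of x y] ai[of x y] bi[of x y]
          by (simp add: Henstock_Kurzweil_Integration.integral_diff integrable_on_mult_right)
        moreover have "norm (integral {x..y} (\<lambda>t. f' \<xi> * a t - b t))
            \<le> integral {x..y} (\<lambda>t. e * \<bar>a t\<bar>)"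
        proof (rule integral_norm_bound_integral)
          show "(\<lambda>t. f' \<xi> * a t - b t) integrable_on {x..y}"
            "(\<lambda>t. e * \<bar>a t\<bar>) integrable_on {x..y}"
            using xy ai[of x y] bi[of x y] an[of x y]
            by (auto intro!: integrable_diff integrable_on_mult_right)
          fix t assume "t \<in> {x..y}"
          from est[OF this] show "norm (f' \<xi> * a t - b t) \<le> e * \<bar>a t\<bar>"
            by (simp add: b_def left_diff_distrib[symmetric] abs_mult mult_right_mono)
        qed
        ultimately show ?thesis by simp
      qed
      \<comment> \<open>The guards sit inside \<open>P\<close> because the local condition of
        \<open>Bolzano\<close> quantifies over all \<open>s\<close> and \<open>t\<close> around
        \<open>x\<close>, including points outside \<open>{0..1}\<close>.\<close>
      define P where "P x y \<longleftrightarrow> (0 \<le> x \<longrightarrow> x \<le> y \<longrightarrow> y \<le> 1 \<longrightarrow>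
          \<bar>f (A y) - f (A x) - integral {x..y} b\<bar> \<le> e * integral {x..y} (\<lambda>t. \<bar>a t\<bar>))" for x y
      have "P 0 z"
      proof (rule Bolzano[of 0 z P])
        show "0 \<le> z" by fact
      next
        fix x y w assume P: "P x y" "P y w" and le: "x \<le> y" "y \<le> w"
        show "P x w"
          unfolding P_def
        proof (intro impI)
          assume *: "0 \<le> x" "x \<le> w" "w \<le> 1"
          have "\<bar>f (A y) - f (A x) - integral {x..y} b\<bar> \<le> e * integral {x..y} (\<lambda>t. \<bar>a t\<bar>)"
            "\<bar>f (A w) - f (A y) - integral {y..w} b\<bar> \<le> e * integral {y..w} (\<lambda>t. \<bar>a t\<bar>)"
            using P le * by (auto simp: P_def)
          moreover have "integral {x..y} b + integral {y..w} b = integral {x..w} b"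
            "integral {x..y} (\<lambda>t. \<bar>a t\<bar>) + integral {y..w} (\<lambda>t. \<bar>a t\<bar>) = integral {x..w} (\<lambda>t. \<bar>a t\<bar>)"
            using le * by (auto intro!: combine bi an)
          moreover have "e * integral {x..w} (\<lambda>t. \<bar>a t\<bar>)
              = e * integral {x..y} (\<lambda>t. \<bar>a t\<bar>) + e * integral {y..w} (\<lambda>t. \<bar>a t\<bar>)"
            by (simp flip: calculation(4) add: distrib_left)
          ultimately show "\<bar>f (A w) - f (A x) - integral {x..w} b\<bar> \<le> e * integral {x..w} (\<lambda>t. \<bar>a t\<bar>)"
            by linarith
        qed
      next
        fix x assume "0 \<le> x" "x \<le> z"
        show "\<exists>d>0. \<forall>s t. s \<le> x \<and> x \<le> t \<and> t - s < d \<longrightarrow> P s t"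
          using loc r(1) by (intro exI[of _ r]) (auto simp: P_def)
      qed
      then show ?thesis using z by (simp add: P_def)
    qed
    then have *: "\<And>e. e > 0 \<Longrightarrow> \<bar>f (A z) - f (A 0) - integral {0..z} b\<bar> \<le> e * integral {0..z} (\<lambda>t. \<bar>a t\<bar>)"
      by blast
    have nn: "0 \<le> integral {0..z} (\<lambda>t. \<bar>a t\<bar>)"
      using z by (intro integral_nonneg an) auto
    have "\<bar>f (A z) - f (A 0) - integral {0..z} b\<bar> \<le> 0 + e" if "e > 0" for e
    proof -
      let ?I = "integral {0..z} (\<lambda>t. \<bar>a t\<bar>)"
      \<comment> \<open>The summand 1 in the denominator covers \<open>?I = 0\<close>.\<close>
      have "\<bar>f (A z) - f (A 0) - integral {0..z} b\<bar> \<le> (e / (1 + ?I)) * ?I"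
        by (rule *) (use that nn in auto)
      also have "\<dots> \<le> e" using that nn by (simp add: field_simps)
      finally show ?thesis by simp
    qed
    then have "\<bar>f (A z) - f (A 0) - integral {0..z} b\<bar> \<le> 0"
      by (rule field_le_epsilon)
    then show ?thesis by simp
  qed
  have "b = (\<lambda>x. f' (A x) * a x)" by (simp add: b_def fun_eq_iff)
  moreover have "f (A z) - f (A 0) = integral {0..z} b" if "z \<in> {0..1}" for z
    using key[of z] that by simp
  ultimately show ?thesis
    unfolding indef_integral_def using bint[of 0 1] by simp
qed

lemma indef_integral_add:
  assumes "indef_integral A a" "indef_integral B b"
  shows "indef_integral (\<lambda>x. A x + B x) (\<lambda>x. a x + b x)"
proof -
  have "a integrable_on {0..x}" "b integrable_on {0..x}" if "x \<in> {0..1}" for x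
    using indef_integral_subinterval[OF assms(1), of 0 x]
      indef_integral_subinterval[OF assms(2), of 0 x] that
    by (auto simp: set_lebesgue_integral_eq_integral)
  then have "A x + B x - (A 0 + B 0) = integral {0..x} (\<lambda>x. a x + b x)" if "x \<in> {0..1}" for x
    using indef_integral_diff[OF assms(1), of 0 x] indef_integral_diff[OF assms(2), of 0 x] that
    by (simp add: Henstock_Kurzweil_Integration.integral_add)
  with assms show ?thesis
    by (simp add: indef_integral_def)
qed

lemma indef_integral_scale:
  assumes "indef_integral A a"
  shows "indef_integral (\<lambda>x. c * A x) (\<lambda>x. c * a x)"
  using assms unfolding indef_integral_def
  by (auto simp flip: right_diff_distrib)

text \<open>Polarization reduces products to squares, hence to the chain rule.\<close>

lemma indef_integral_mult:
  assumes "indef_integral A a" "indef_integral B b"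
  shows "indef_integral (\<lambda>x. A x * B x) (\<lambda>x. a x * B x + A x * b x)"
proof -
  have sq: "indef_integral (\<lambda>x. (C x)\<^sup>2) (\<lambda>x. 2 * C x * c x)" if "indef_integral C c" for C c
    by (rule indef_integral_chain[OF that, of "\<lambda>x. x\<^sup>2" "\<lambda>x. 2 * x"])
      (auto intro!: derivative_eq_intros continuous_intros)
  have "indef_integral (\<lambda>x. A x + (-1) * B x) (\<lambda>x. a x + (-1) * b x)"
    by (intro indef_integral_add indef_integral_scale assms)
  from indef_integral_scale[OF indef_integral_add[OF sq[OF indef_integral_add[OF assms]]
        indef_integral_scale[OF sq[OF this], of "-1"]], of "1/4"]
  \<comment> \<open>\<open>((A + B)\<^sup>2 - (A - B)\<^sup>2) / 4\<close> and its density agree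
    pointwise with the wanted functions; as a pair, both are replaced by a single
    substitution.\<close>
  show ?thesis
    by (rule back_subst[where P = "\<lambda>p. indef_integral (fst p) (snd p)",
          where a = "(_, _)" and b = "(_, _)", unfolded fst_conv snd_conv])
      (auto simp: fun_eq_iff power2_eq_square algebra_simps)
qed

lemma indef_integral_C1:
  assumes "\<phi> C1_differentiable_on UNIV"
  shows "indef_integral \<phi> (deriv \<phi>)"
proof -
  have "indef_integral (\<lambda>x. x) (\<lambda>_. 1)"
    by (auto simp: indef_integral_def)
  from indef_integral_chain[OF this C1_UNIV(1,2)[OF assms]] show ?thesis by simp
qed


section \<open>Weak derivatives\<close>

text \<open>The end points form a null set. This passes from the open interval of \<open>I01\<close>
  to the closed intervals used by \<open>indef_integral\<close>.\<close>

lemma integrable_I01_iff: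
  fixes f :: "real \<Rightarrow> real"
  shows "integrable I01 f \<longleftrightarrow> f absolutely_integrable_on {0..1}"
  using absolutely_integrable_on_open_interval[where f = f and a = 0 and b = "1::real"]
  by (simp add: integrable_restrict_space set_integrable_def box_real)

lemma integral_I01_eq:
  fixes f :: "real \<Rightarrow> real"
  assumes "integrable I01 f"
  shows "(LINT x|I01. f x) = integral {0..1} f"
  using lebesgue_integral_eq_integral[OF assms] integral_open_interval_real[of 0 1 f] by simp

lemma integral_I01_const: "(LINT x|I01. (c::real)) = c"
  by (simp add: measure_restrict_space)

lemma L2_continuous_on:
  assumes "continuous_on {0..1} f"
  shows "f \<in> L2"
proof -
  have c: "continuous_on {0<..<1} f" by (rule continuous_on_subset[OF assms]) auto
  have "continuous_on {0..1} (\<lambda>x. (f x)\<^sup>2)" by (intro continuous_intros assms)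
  then have "integrable I01 (\<lambda>x. (f x)\<^sup>2)"
    by (simp add: integrable_I01_iff absolutely_integrable_continuous_real)
  with continuous_imp_measurable_on_sets_lebesgue[OF c] show ?thesis
    by (simp add: L2_def)
qed

lemma indef_integral_L2: "indef_integral A a \<Longrightarrow> A \<in> L2"
  by (intro L2_continuous_on indef_integral_continuous)

text \<open>The product rule integrated over the unit interval. The boundary terms are kept because
  they are read in three ways: they vanish for compactly supported tests, they cancel for periodic
  tests when \<open>A 0 = A 1\<close>, and conversely they detect \<open>A 1 - A 0\<close>.\<close>

lemma indef_integral_by_parts:
  assumes A: "indef_integral A a" and \<phi>: "\<phi> C1_differentiable_on UNIV"
  shows "(LINT x|I01. A x * deriv \<phi> x) = A 1 * \<phi> 1 - A 0 * \<phi> 0 - (LINT x|I01. a x * \<phi> x)"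
proof -
  note c = C1_UNIV(2,3)[OF \<phi>]
  have 1: "integrable I01 (\<lambda>x. A x * deriv \<phi> x)"
    using A c(1) by (intro L2_mult L2_continuous indef_integral_L2)
  have "(\<lambda>x. \<phi> x * a x) absolutely_integrable_on {0..1}"
    using A by (intro absolutely_integrable_continuous_times continuous_on_subset[OF c(2)])
      (auto simp: indef_integral_def)
  then have 2: "integrable I01 (\<lambda>x. a x * \<phi> x)"
    by (simp add: integrable_I01_iff mult.commute)
  have "indef_integral (\<lambda>x. A x * \<phi> x) (\<lambda>x. a x * \<phi> x + A x * deriv \<phi> x)"
    by (rule indef_integral_mult[OF A indef_integral_C1[OF \<phi>]])
  from indef_integral_diff[OF this, of 0 1]
  have "A 1 * \<phi> 1 - A 0 * \<phi> 0 = (LINT x|I01. a x * \<phi> x + A x * deriv \<phi> x)"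
    by (simp add: integral_I01_eq[OF Bochner_Integration.integrable_add[OF 2 1]])
  also have "\<dots> = (LINT x|I01. a x * \<phi> x) + (LINT x|I01. A x * deriv \<phi> x)"
    by (rule Bochner_Integration.integral_add[OF 2 1])
  finally show ?thesis by simp
qed

lemma indef_integral_weak_deriv_interval:
  assumes "indef_integral A a"
  shows "weak_deriv_interval A a"
  unfolding weak_deriv_interval_def
proof (intro allI impI)
  fix \<phi> assume t: "test_interval \<phi>"
  then have "0 \<notin> {x. \<phi> x \<noteq> 0}" "1 \<notin> {x. \<phi> x \<noteq> 0}"
    using closure_subset[of "{x. \<phi> x \<noteq> 0}"] by (fastforce simp: test_interval_def)+
  then show "(LINT x|I01. A x * deriv \<phi> x) = - (LINT x|I01. a x * \<phi> x)"
    using indef_integral_by_parts[OF assms test_interval_C1[OF t]] by simp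
qed

lemma indef_integral_weak_deriv_circle:
  assumes "indef_integral A a" "A 0 = A 1"
  shows "weak_deriv_circle A a"
  unfolding weak_deriv_circle_def
proof (intro allI impI)
  fix \<phi> assume t: "test_circle \<phi>"
  then have "\<phi> (0 + 1) = \<phi> 0" unfolding test_circle_def by blast
  then show "(LINT x|I01. A x * deriv \<phi> x) = - (LINT x|I01. a x * \<phi> x)"
    using indef_integral_by_parts[OF assms(1), of \<phi>] t assms(2) by (simp add: test_circle_def)
qed

text \<open>Subtracting the primitive of \<open>w\<close> leaves a function with weak derivative 0,
  which is constant almost everywhere; the constant is absorbed into the representative.\<close>

lemma weak_deriv_interval_imp_indef_integral:
  assumes "u \<in> L2" "w \<in> L2" "weak_deriv_interval u w"
  obtains A where "indef_integral A w" "AE x in I01. u x = A x"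
proof -
  define B where "B x = integral {0..x} w" for x
  have B: "indef_integral B w"
    using L2_integrable[OF assms(2)] by (simp add: indef_integral_def B_def integrable_I01_iff)
  have "weak_deriv_interval (\<lambda>x. u x + (-1) * B x) (\<lambda>x. w x + (-1) * w x)"
    by (intro weak_deriv_add weak_deriv_scale L2_scale assms indef_integral_L2[OF B]
        indef_integral_weak_deriv_interval[OF B])
  then have "weak_deriv_interval (\<lambda>x. u x + (-1) * B x) (\<lambda>x. 0)" by simp
  moreover have "(\<lambda>x. u x + (-1) * B x) \<in> L2"
    by (intro L2_add L2_scale assms indef_integral_L2[OF B])
  ultimately obtain c where "AE x in I01. u x + (-1) * B x = c"
    using weak_deriv_const by blast
  then have "AE x in I01. u x = B x + c" by eventually_elim simp
  moreover have "indef_integral (\<lambda>x. B x + c) w"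
    using B by (simp add: indef_integral_def)
  ultimately show thesis by (rule that[rotated])
qed

text \<open>The test functions \<open>(cos (\<pi> x))\<^sup>2\<^sup>n\<close> concentrate at the end points of the interval.\<close>

lemma weak_deriv_circle_imp_periodic:
  assumes A: "indef_integral A a" and b: "integrable I01 b" and w: "weak_deriv_circle A b"
  shows "A 0 = A 1"
proof -
  define \<phi> where "\<phi> n x = (cos (pi * x)) ^ (2 * n)" for n :: nat and x
  have a: "integrable I01 a" using A by (simp add: indef_integral_def integrable_I01_iff)
  have c: "continuous_on UNIV (\<phi> n)" for n
    unfolding \<phi>_def by (intro continuous_intros)
  have C1: "\<phi> n C1_differentiable_on UNIV" for n
  proof (rule C1I)
    \<comment> \<open>At \<open>n = 0\<close> the truncated exponent \<open>2 * n - 1\<close> is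
      harmless, since the factor \<open>real (2 * n)\<close> vanishes.\<close>
    show "(\<phi> n has_real_derivative
        real (2 * n) * (cos (pi * x)) ^ (2 * n - 1) * (- sin (pi * x) * pi)) (at x)" for x
      unfolding \<phi>_def by (auto intro!: derivative_eq_intros)
  qed (intro continuous_intros)
  \<comment> \<open>Even powers remove the sign in
    \<open>cos (pi * (x + 1)) = - cos (pi * x)\<close>.\<close>
  have "test_circle (\<phi> n)" for n
    using C1[of n] by (auto simp: test_circle_def \<phi>_def distrib_left power_mult)
  then have "(LINT x|I01. A x * deriv (\<phi> n) x) = - (LINT x|I01. b x * \<phi> n x)" for n
    using w by (simp add: weak_deriv_circle_def)
  moreover have "\<phi> n 1 = 1" "\<phi> n 0 = 1" for n
    by (simp_all add: \<phi>_def power_mult)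
  \<comment> \<open>The left-hand side does not depend on \<open>n\<close>, whereas both integrals
    tend to 0 by dominated convergence.\<close>
  ultimately have eq: "A 1 - A 0 = (LINT x|I01. a x * \<phi> n x) - (LINT x|I01. b x * \<phi> n x)" for n
    using indef_integral_by_parts[OF A C1, of n] by simp
  have lim: "(\<lambda>n. LINT x|I01. g x * \<phi> n x) \<longlonglongrightarrow> (LINT x|I01. 0)" if g: "integrable I01 g" for g :: "real \<Rightarrow> real"
  proof (rule integral_dominated_convergence[where w = "\<lambda>x. \<bar>g x\<bar>"])
    show "AE x in I01. (\<lambda>n. g x * \<phi> n x) \<longlonglongrightarrow> 0"
    proof (rule AE_I2)
      fix x assume "x \<in> space I01"
      then have x: "0 < x" "x < 1" by auto
      have "cos (pi * x) < cos 0" "cos pi < cos (pi * x)"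
        using x by (intro cos_monotone_0_pi; simp)+
      then have "\<bar>(cos (pi * x))\<^sup>2\<bar> < 1" by (simp add: abs_square_less_1 abs_less_iff)
      then have "(\<lambda>n. ((cos (pi * x))\<^sup>2) ^ n) \<longlonglongrightarrow> 0"
        by (intro LIMSEQ_power_zero) simp
      then show "(\<lambda>n. g x * \<phi> n x) \<longlonglongrightarrow> 0"
        unfolding \<phi>_def power_mult by (rule tendsto_mult_right_zero)
    qed
    show "AE x in I01. norm (g x * \<phi> n x) \<le> \<bar>g x\<bar>" for n
    proof (rule AE_I2)
      fix x
      have "\<bar>\<phi> n x\<bar> \<le> 1" by (simp add: \<phi>_def power_abs power_le_one)
      then show "norm (g x * \<phi> n x) \<le> \<bar>g x\<bar>" by (simp add: abs_mult mult_left_le)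
    qed
    show "(\<lambda>x. g x * \<phi> n x) \<in> borel_measurable I01" for n
      using g L2_continuous[OF c[of n]] by (auto simp: L2_def)
  qed (use g in auto)
  have "(\<lambda>n. (LINT x|I01. a x * \<phi> n x) - (LINT x|I01. b x * \<phi> n x)) \<longlonglongrightarrow> 0 - 0"
    using lim[OF a] lim[OF b] by (intro tendsto_diff) simp_all
  then show ?thesis by (simp flip: eq add: LIMSEQ_const_iff)
qed

lemma weak_deriv_circle_cong:
  assumes "u \<in> L2" "w \<in> L2" "AE x in I01. u x = w x"
  shows "weak_deriv_circle u v \<longleftrightarrow> weak_deriv_circle w v"
proof -
  have "(LINT x|I01. u x * deriv \<phi> x) = (LINT x|I01. w x * deriv \<phi> x)"
    if t: "test_circle \<phi>" for \<phi>
  proof (rule integral_cong_AE)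
    have \<phi>: "deriv \<phi> \<in> L2" using C1_L2 t by (auto simp: test_circle_def)
    show "(\<lambda>x. u x * deriv \<phi> x) \<in> borel_measurable I01"
      "(\<lambda>x. w x * deriv \<phi> x) \<in> borel_measurable I01"
      using L2_mult[OF assms(1) \<phi>] L2_mult[OF assms(2) \<phi>] by auto
    show "AE x in I01. u x * deriv \<phi> x = w x * deriv \<phi> x"
      using assms(3) by eventually_elim simp
  qed
  then show ?thesis by (simp add: weak_deriv_circle_def)
qed

text \<open>Replaces the two weak conditions on the derivative by one representative with equal end
  values. The interval derivative \<open>w\<close> and the circle derivative \<open>b\<close> are
  never compared: periodicity follows from the mere existence of an integrable \<open>b\<close>, and
  conversely \<open>w\<close> serves in both roles.\<close>

lemma H_per_ave_2_iff:
  "u \<in> H_per_ave 2 \<longleftrightarrow> u \<in> H_per_ave 1 \<and>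
     (\<exists>V w. w \<in> L2 \<and> indef_integral V w \<and> V 0 = V 1 \<and> (AE x in I01. wderiv u x = V x))"
    (is "_ \<longleftrightarrow> _ \<and> ?P")
proof
  assume u: "u \<in> H_per_ave 2"
  then obtain v w where v: "u \<in> L2" "v \<in> L2" "weak_deriv_interval u v" "w \<in> L2"
    "weak_deriv_interval v w"
    by (auto simp: H_per_ave_def numeral_2_eq_2)
  have m: "(LINT x|I01. u x) = 0" using u by (simp add: H_per_ave_def)
  note 1 = H_per_ave_1I[OF v(1,2,3) m]
  have d2: "wderiv u \<in> L2" using 1(1) by (simp add: H_per_ave_1_iff)
  obtain V where V: "indef_integral V w" "AE x in I01. v x = V x"
    using weak_deriv_interval_imp_indef_integral[OF v(2,4,5)] .
  have dV: "AE x in I01. wderiv u x = V x"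
    using 1(2) V(2) by eventually_elim simp
  obtain b where b: "b \<in> L2" "weak_deriv_circle (wderiv u) b"
    using u by (auto simp: H_per_ave_def)
  then have "weak_deriv_circle V b"
    using weak_deriv_circle_cong[OF d2 indef_integral_L2[OF V(1)] dV] by simp
  then have "V 0 = V 1"
    by (rule weak_deriv_circle_imp_periodic[OF V(1) L2_integrable[OF b(1)]])
  with 1 V(1) dV v(4) show "u \<in> H_per_ave 1 \<and> ?P" by auto
next
  assume *: "u \<in> H_per_ave 1 \<and> ?P"
  then obtain V w where V: "w \<in> L2" "indef_integral V w" "V 0 = V 1" "AE x in I01. wderiv u x = V x"
    by blast
  have u: "u \<in> L2" "wderiv u \<in> L2" "weak_deriv_interval u (wderiv u)" "(LINT x|I01. u x) = 0"
    using * by (simp_all add: H_per_ave_1_iff)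
  note V2 = indef_integral_L2[OF V(2)]
  have "weak_deriv_interval (wderiv u) w"
    using weak_deriv_cong[OF u(2) V2 V(4)] indef_integral_weak_deriv_interval[OF V(2)] by simp
  moreover have "weak_deriv_circle (wderiv u) w"
    using weak_deriv_circle_cong[OF u(2) V2 V(4)] indef_integral_weak_deriv_circle[OF V(2,3)] by simp
  ultimately show "u \<in> H_per_ave 2"
    using u V(1) by (auto simp: H_per_ave_def numeral_2_eq_2)
qed


section \<open>The one-variable Lojasiewicz inequality\<close>

lemma real_analytic_power_series:
  assumes "real_analytic f"
  obtains r c where "r > 0" "\<And>t. \<bar>t\<bar> < r \<Longrightarrow> (\<lambda>n. c n * t ^ n) sums f (a + t)"
proof -
  obtain r c where "r > 0" "\<And>x. \<bar>x - a\<bar> < r \<Longrightarrow> (\<lambda>n. c n * (x - a) ^ n) sums f x"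
    using assms unfolding real_analytic_def by blast
  from that[OF this(1), of c] this(2)[of "a + _"] show thesis by simp
qed

lemma power_series_has_derivative:
  fixes c :: "nat \<Rightarrow> real"
  assumes "\<And>t. \<bar>t\<bar> < r \<Longrightarrow> summable (\<lambda>n. c n * t ^ n)" "\<bar>t\<bar> < r"
  shows "((\<lambda>t. \<Sum>n. c n * t ^ n) has_real_derivative (\<Sum>n. diffs c n * t ^ n)) (at t)"
    and "summable (\<lambda>n. diffs c n * t ^ n)"
proof -
  obtain K where K: "\<bar>t\<bar> < K" "K < r" using assms(2) dense by blast
  have sK: "summable (\<lambda>n. c n * K ^ n)" using assms(1)[of K] K by simp
  show "((\<lambda>t. \<Sum>n. c n * t ^ n) has_real_derivative (\<Sum>n. diffs c n * t ^ n)) (at t)"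
    by (rule termdiffs_strong[OF sK]) (use K in simp)
  show "summable (\<lambda>n. diffs c n * t ^ n)"
    by (rule termdiff_converges[of _ K]) (use K assms(1) in auto)
qed

lemma real_analytic_has_derivative:
  assumes "real_analytic f"
  shows "(f has_real_derivative deriv f a) (at a)"
proof -
  obtain r c where r: "r > 0" "\<And>t. \<bar>t\<bar> < r \<Longrightarrow> (\<lambda>n. c n * t ^ n) sums f (a + t)"
    using real_analytic_power_series[OF assms] by blast
  have "((\<lambda>t. \<Sum>n. c n * t ^ n) has_real_derivative (\<Sum>n. diffs c n * 0 ^ n)) (at 0)"
    using r by (intro power_series_has_derivative(1)[of r]) (auto dest: sums_summable)
  then have "((\<lambda>t. f (a + t)) has_real_derivative (\<Sum>n. diffs c n * 0 ^ n)) (at 0)"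
    by (rule has_field_derivative_transform_within_open[where S = "{-r<..<r}"])
      (use r in \<open>auto simp: sums_iff\<close>)
  then have "(f has_real_derivative (\<Sum>n. diffs c n * 0 ^ n)) (at a)"
    using DERIV_shift[of f _ 0 a] by (simp add: add.commute)
  then show ?thesis by (simp add: DERIV_imp_deriv)
qed

text \<open>Here \<open>m\<close> is the order of vanishing of \<open>f - f a\<close> at
  \<open>a\<close>, and \<open>h\<close> collects the remaining power series. The bound
  \<open>2 \<le> m\<close> is what later makes the exponent \<open>1 / m\<close> at most
  \<open>1 / 2\<close>. A locally constant \<open>f\<close> has no such order and forms its own
  case.\<close>

lemma real_analytic_factor:
  assumes f: "real_analytic f" and 0: "deriv f a = 0"
  obtains (const) r where "r > 0" "\<And>t. \<bar>t\<bar> < r \<Longrightarrow> f (a + t) = f a"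
  | (order) r m h h' where "r > 0" "2 \<le> (m::nat)" "h 0 \<noteq> 0"
      "\<And>t. \<bar>t\<bar> < r \<Longrightarrow> f (a + t) = f a + t ^ m * h t"
      "\<And>t. \<bar>t\<bar> < r \<Longrightarrow> (h has_real_derivative h' t) (at t)" "isCont h' 0"
proof -
  obtain r c where r: "r > 0" "\<And>t. \<bar>t\<bar> < r \<Longrightarrow> (\<lambda>n. c n * t ^ n) sums f (a + t)"
    using real_analytic_power_series[OF f] by blast
  have c0: "c 0 = f a"
    using r(2)[of 0] r(1) powser_sums_zero_iff[of c "f a"] by simp
  show thesis
  proof (cases "\<forall>n\<ge>1. c n = 0")
    case True
    show thesis
    proof (rule const[OF r(1)])
      fix t assume "\<bar>t\<bar> < r"
      note r(2)[OF this]
      moreover have "(\<lambda>n. c n * t ^ n) = (\<lambda>n. if n = 0 then f a else 0)"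
        using True c0 by (auto simp: fun_eq_iff)
      moreover have "(\<lambda>n. if n = 0 then f a else 0) sums f a"
        using sums_single[of 0 "\<lambda>_. f a"] by simp
      ultimately show "f (a + t) = f a" using sums_unique2 by metis
    qed
  next
    case False
    define m where "m = (LEAST n. 1 \<le> n \<and> c n \<noteq> 0)"
    have m: "1 \<le> m" "c m \<noteq> 0"
      using LeastI_ex[of "\<lambda>n. 1 \<le> n \<and> c n \<noteq> 0"] False by (auto simp: m_def)
    have below: "c n = 0" if "1 \<le> n" "n < m" for n
      using not_less_Least[of n "\<lambda>n. 1 \<le> n \<and> c n \<noteq> 0"] that by (auto simp: m_def)
    define h where "h t = (\<Sum>n. c (n + m) * t ^ n)" for t
    define h' where "h' t = (\<Sum>n. diffs (\<lambda>n. c (n + m)) n * t ^ n)" for t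
    have split: "summable (\<lambda>n. c (n + m) * t ^ n)" "f (a + t) = f a + t ^ m * h t" if t: "\<bar>t\<bar> < r" for t
    proof -
      have "(\<Sum>i<m. c i * t ^ i) = (\<Sum>i\<in>{0}. c i * t ^ i)"
      proof (rule sum.mono_neutral_right)
        show "\<forall>i\<in>{..<m} - {0}. c i * t ^ i = 0"
          using below by (auto simp: Suc_le_eq)
      qed (use m(1) in auto)
      then have "(\<lambda>n. c (n + m) * t ^ (n + m)) sums (f (a + t) - f a)"
        using sums_split_initial_segment[OF r(2)[OF t], of m] c0 by simp
      then have *: "(\<lambda>n. t ^ m * (c (n + m) * t ^ n)) sums (f (a + t) - f a)"
        by (simp add: power_add mult_ac)
      show s: "summable (\<lambda>n. c (n + m) * t ^ n)"
      proof (cases "t = 0")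
        case True
        then show ?thesis using powser_sums_zero[of "\<lambda>n. c (n + m)"] by (simp add: sums_iff)
      next
        case False
        then show ?thesis using sums_summable[OF *] by (simp add: summable_cmult_iff)
      qed
      have "(\<lambda>n. t ^ m * (c (n + m) * t ^ n)) sums (t ^ m * h t)"
        unfolding h_def using s by (intro sums_mult summable_sums)
      with * have "f (a + t) - f a = t ^ m * h t" by (rule sums_unique2)
      then show "f (a + t) = f a + t ^ m * h t" by simp
    qed
    have h: "(h has_real_derivative h' t) (at t)" if "\<bar>t\<bar> < r" for t
      unfolding h_def h'_def using split(1) that by (rule power_series_has_derivative(1)) auto
    have s': "summable (\<lambda>n. diffs (\<lambda>n. c (n + m)) n * t ^ n)" if "\<bar>t\<bar> < r" for t
      using split(1) that by (rule power_series_has_derivative(2)) auto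
    have "isCont h' 0"
      unfolding h'_def using power_series_has_derivative(1)[of r, OF s', of 0] r(1)
      by (intro DERIV_isCont) auto
    have h0: "h 0 = c m" unfolding h_def using powser_zero[of "\<lambda>n. c (n + m)"] by simp
    have "((\<lambda>t. f (a + t)) has_real_derivative 0) (at 0)"
      using real_analytic_has_derivative[OF f, of a] 0 DERIV_shift[of f 0 0 a] by (simp add: add.commute)
    \<comment> \<open>With \<open>m = 1\<close> the derivative at \<open>a\<close> would be
      \<open>c 1\<close>, which is nonzero by the choice of \<open>m\<close>.\<close>
    moreover have "((\<lambda>t. f (a + t)) has_real_derivative c 1) (at 0)" if "m = 1"
    proof (rule has_field_derivative_transform_within_open[where S = "{-r<..<r}" and f = "\<lambda>t. f a + t * h t"])
      show "((\<lambda>t. f a + t * h t) has_real_derivative c 1) (at 0)"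
        using r(1) h0 that by (auto intro!: derivative_eq_intros h)
    qed (use r(1) that split(2) in auto)
    ultimately have "m \<noteq> 1" using DERIV_unique m(2) by blast
    then have "2 \<le> m" using m(1) by simp
    then show thesis
      using order[OF r(1) _ _ split(2) h \<open>isCont h' 0\<close>] h0 m(2) by simp
  qed
qed

text \<open>Since \<open>f (a + t) - f a = t ^ m * h t\<close>, the derivative is
  \<open>t ^ (m - 1) * Q t\<close> with \<open>Q 0 = m * h 0 \<noteq> 0\<close>. The choice
  \<open>\<theta> = 1 / m\<close> is made so that
  \<open>(\<bar>t\<bar> ^ m) powr (1 - \<theta>)\<close> is exactly
  \<open>\<bar>t\<bar> ^ (m - 1)\<close>.\<close>

lemma lojasiewicz_real:
  assumes f: "real_analytic f" and 0: "deriv f a = 0"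
  obtains r \<theta> C where "r > 0" "0 < \<theta>" "\<theta> \<le> 1 / 2" "C > 0"
    "\<And>x. \<bar>x - a\<bar> < r \<Longrightarrow> C * \<bar>f x - f a\<bar> powr (1 - \<theta>) \<le> \<bar>deriv f x\<bar>"
  using f 0
proof (cases rule: real_analytic_factor)
  case (const r)
  show thesis
  \<comment> \<open>The left-hand side is \<open>0 powr (1 / 2) = 0\<close>, so any admissible
    constants work.\<close>
  proof (rule that[of r "1/2" 1])
    fix x assume "\<bar>x - a\<bar> < r"
    with const(2)[of "x - a"] show "1 * \<bar>f x - f a\<bar> powr (1 - 1/2) \<le> \<bar>deriv f x\<bar>" by simp
  qed (use const(1) in auto)
next
  case (order r m h h')
  define Q where "Q t = real m * h t + t * h' t" for t
  have "isCont h 0" using order(5)[of 0] order(1) by (intro DERIV_isCont) auto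
  then have "isCont Q 0" unfolding Q_def[abs_def] using order(6) by (intro continuous_intros)
  then have "(\<lambda>t. \<bar>Q t\<bar>) \<midarrow>0\<rightarrow> \<bar>Q 0\<bar>" "(\<lambda>t. \<bar>h t\<bar>) \<midarrow>0\<rightarrow> \<bar>h 0\<bar>"
    using \<open>isCont h 0\<close> unfolding isCont_def by (auto intro: tendsto_rabs)
  \<comment> \<open>Half of \<open>\<bar>Q 0\<bar>\<close>, so that by continuity
    \<open>\<bar>Q t\<bar>\<close> stays above \<open>B\<close> for small \<open>t\<close>.\<close>
  moreover define B where "B = \<bar>real m * h 0\<bar> / 2"
  moreover have B: "0 < B" "B < \<bar>Q 0\<bar>" using order(2,3) by (auto simp: B_def Q_def abs_mult)
  ultimately have "\<forall>\<^sub>F t in at 0. B < \<bar>Q t\<bar>" "\<forall>\<^sub>F t in at 0. \<bar>h t\<bar> < \<bar>h 0\<bar> + 1"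
    by (auto intro: order_tendstoD)
  then have "\<forall>\<^sub>F t in at 0. B < \<bar>Q t\<bar> \<and> \<bar>h t\<bar> < \<bar>h 0\<bar> + 1" by eventually_elim simp
  then obtain d where d: "d > 0" "\<And>t. t \<noteq> 0 \<Longrightarrow> \<bar>t\<bar> < d \<Longrightarrow> B < \<bar>Q t\<bar> \<and> \<bar>h t\<bar> < \<bar>h 0\<bar> + 1"
    by (auto simp: eventually_at)
  define A where "A = \<bar>h 0\<bar> + 1"
  define \<theta> where "\<theta> = 1 / real m"
  have \<theta>: "0 < \<theta>" "\<theta> \<le> 1 / 2" "0 < 1 - \<theta>" using order(2) by (auto simp: \<theta>_def field_simps)
  have A: "0 < A" by (simp add: A_def)
  show thesis
  \<comment> \<open>The constant is the lower bound of \<open>\<bar>Q t\<bar>\<close> divided by the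
    upper bound of \<open>\<bar>h t\<bar> powr (1 - \<theta>)\<close>.\<close>
  proof (rule that[of "min r d" \<theta> "B / A powr (1 - \<theta>)"])
    show "0 < min r d" "0 < B / A powr (1 - \<theta>)" using order(1) d(1) B(1) A by auto
    fix x assume x: "\<bar>x - a\<bar> < min r d"
    define t where "t = x - a"
    have t: "\<bar>t\<bar> < r" "\<bar>t\<bar> < d" "x = a + t" using x by (auto simp: t_def)
    show "B / A powr (1 - \<theta>) * \<bar>f x - f a\<bar> powr (1 - \<theta>) \<le> \<bar>deriv f x\<bar>"
    \<comment> \<open>The bounds on \<open>Q\<close> and \<open>h\<close> were obtained on a
      punctured neighborhood; at \<open>t = 0\<close> the left-hand side vanishes.\<close>
    proof (cases "t = 0")
      case True
      then show ?thesis using t(3) by simp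
    next
      case False
      have "((\<lambda>t. f (a + t)) has_real_derivative t ^ (m - 1) * Q t) (at t)"
      proof (rule has_field_derivative_transform_within_open[where S = "{-r<..<r}" and f = "\<lambda>t. f a + t ^ m * h t"])
        have "((\<lambda>t. f a + t ^ m * h t) has_real_derivative
            0 + (real m * t ^ (m - Suc 0) * h t + h' t * t ^ m)) (at t)"
          by (intro DERIV_add DERIV_const DERIV_mult DERIV_pow order(5) t(1))
        moreover obtain k where "m = Suc k" using order(2) by (cases m) auto
        ultimately show "((\<lambda>t. f a + t ^ m * h t) has_real_derivative t ^ (m - 1) * Q t) (at t)"
          by (simp add: Q_def algebra_simps)
      qed (use t(1) order(4) in auto)
      then have "(f has_real_derivative t ^ (m - 1) * Q t) (at x)"
        using DERIV_shift[of f _ t a] t(3) by (simp add: add.commute)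
      then have df: "\<bar>deriv f x\<bar> = \<bar>t\<bar> ^ (m - 1) * \<bar>Q t\<bar>"
        by (simp add: DERIV_imp_deriv abs_mult power_abs)
      have "\<bar>f x - f a\<bar> powr (1 - \<theta>) = (\<bar>t\<bar> ^ m * \<bar>h t\<bar>) powr (1 - \<theta>)"
        using order(4)[OF t(1)] t(3) by (simp add: abs_mult power_abs)
      also have "\<dots> \<le> (\<bar>t\<bar> ^ m * A) powr (1 - \<theta>)"
        using d(2)[OF False t(2)] \<theta>(3) by (intro powr_mono2 mult_left_mono) (auto simp: A_def)
      also have "\<dots> = (\<bar>t\<bar> ^ m) powr (1 - \<theta>) * A powr (1 - \<theta>)"
        using A by (simp add: powr_mult)
      also have "(\<bar>t\<bar> ^ m) powr (1 - \<theta>) = \<bar>t\<bar> powr (real m * (1 - \<theta>))"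
        using False by (simp add: powr_powr flip: powr_realpow)
      also have "real m * (1 - \<theta>) = real (m - 1)"
        using order(2) by (simp add: \<theta>_def field_simps)
      also have "\<bar>t\<bar> powr real (m - 1) = \<bar>t\<bar> ^ (m - 1)"
        using False by (simp add: powr_realpow)
      finally have "B / A powr (1 - \<theta>) * \<bar>f x - f a\<bar> powr (1 - \<theta>)
          \<le> B / A powr (1 - \<theta>) * (\<bar>t\<bar> ^ (m - 1) * A powr (1 - \<theta>))"
        using B(1) by (intro mult_left_mono) auto
      also have "\<dots> = \<bar>t\<bar> ^ (m - 1) * B" using A by simp
      also have "\<dots> \<le> \<bar>deriv f x\<bar>"
        unfolding df using d(2)[OF False t(2)] by (intro mult_left_mono) auto
      finally show ?thesis .
    qed
  qed (use \<theta> in auto)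
qed


section \<open>The gradient of the energy\<close>

text \<open>The derivative of the length integrand \<open>sqrt (1 + p\<^sup>2)\<close>;
  \<open>slope'\<close> below is the second derivative.\<close>

definition slope :: "real \<Rightarrow> real" where
  "slope p = p / sqrt (1 + p\<^sup>2)"

definition slope' :: "real \<Rightarrow> real" where
  "slope' p = 1 / ((1 + p\<^sup>2) * sqrt (1 + p\<^sup>2))"

lemma one_plus_square_pos: "0 < 1 + (p::real)\<^sup>2"
  by (rule add_pos_nonneg) auto

lemma slope_has_derivative: "(slope has_real_derivative slope' p) (at p)"
proof -
  have "sqrt (1 + p\<^sup>2) \<noteq> 0" using one_plus_square_pos[of p] by simp
  then show ?thesis
    unfolding slope_def[abs_def] slope'_def
    using one_plus_square_pos[of p]
    apply (auto intro!: derivative_eq_intros)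
    apply (simp add: field_simps power2_eq_square)
    done
qed

lemma continuous_slope': "continuous_on UNIV slope'"
  unfolding slope'_def[abs_def] using one_plus_square_pos
  by (intro continuous_intros) (auto simp: less_imp_neq[THEN not_sym])

lemma slope_square: "(slope p)\<^sup>2 = p\<^sup>2 / (1 + p\<^sup>2)"
  using one_plus_square_pos[of p] by (simp add: slope_def power_divide)

lemma abs_slope_le: "\<bar>slope p\<bar> \<le> 1"
proof -
  have "(slope p)\<^sup>2 \<le> 1" using one_plus_square_pos[of p] by (simp add: slope_square)
  then show ?thesis by (simp add: abs_square_le_1)
qed

lemma slope_eq_0_iff: "slope p = 0 \<longleftrightarrow> p = 0"
  using one_plus_square_pos[of p] by (simp add: slope_def)

text \<open>The upper bound is \<open>2 s w \<le> s\<^sup>2 + w\<^sup>2\<close>, the lower one the Cauchy--Schwarz inequality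
  for \<open>(1, p)\<close> and \<open>(1, p + q)\<close>.\<close>

lemma sqrt_one_plus_square_expansion:
  "\<bar>sqrt (1 + (p + q)\<^sup>2) - sqrt (1 + p\<^sup>2) - slope p * q\<bar> \<le> q\<^sup>2 / 2"
proof -
  define s w where "s = sqrt (1 + p\<^sup>2)" and "w = sqrt (1 + (p + q)\<^sup>2)"
  have s: "1 \<le> s" "s\<^sup>2 = 1 + p\<^sup>2" and w: "0 \<le> w" "w\<^sup>2 = 1 + (p + q)\<^sup>2"
    by (simp_all add: s_def w_def)
  have sl: "s * slope p = p" using s(1) by (simp add: slope_def s_def[symmetric])
  have "0 \<le> (w - s)\<^sup>2" by simp
  then have "2 * (s * w) \<le> 2 * s\<^sup>2 + 2 * p * q + q\<^sup>2"
    using s(2) w(2) by (simp add: power2_eq_square algebra_simps)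
  \<comment> \<open>Enlarging \<open>q\<^sup>2\<close> by the factor \<open>s\<close> lets
    \<open>s\<close> be cancelled from both sides afterwards.\<close>
  moreover have "q\<^sup>2 \<le> s * q\<^sup>2" using s(1) mult_right_mono[of 1 s "q\<^sup>2"] by simp
  ultimately have "s * (w - s - slope p * q) \<le> s * (q\<^sup>2 / 2)"
    using sl by (simp add: right_diff_distrib power2_eq_square flip: mult.assoc)
  then have up: "w - s - slope p * q \<le> q\<^sup>2 / 2" using s(1) by simp
  have "(1 + p * (p + q))\<^sup>2 \<le> (s * w)\<^sup>2"
  proof -
    have "(s * w)\<^sup>2 - (1 + p * (p + q))\<^sup>2 = q\<^sup>2"
      unfolding power_mult_distrib s(2) w(2) by (simp add: power2_eq_square algebra_simps)
    then show ?thesis by (smt (verit) zero_le_power2)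
  qed
  then have "1 + p * (p + q) \<le> s * w"
    by (rule power2_le_imp_le) (use s w in auto)
  then have "s * 0 \<le> s * (w - s - slope p * q)"
    using sl s(2) by (simp add: right_diff_distrib power2_eq_square distrib_left flip: mult.assoc)
  then have "0 \<le> w - s - slope p * q" using s(1) by (simp add: zero_le_mult_iff)
  with up show ?thesis by (simp add: s_def w_def)
qed

lemma L2_measurable: "f \<in> L2 \<Longrightarrow> f \<in> borel_measurable I01"
  by (simp add: L2_def)

lemma L2_bounded:
  assumes "f \<in> borel_measurable I01" "\<And>x. \<bar>f x\<bar> \<le> B"
  shows "f \<in> L2"
proof -
  have "integrable I01 (\<lambda>x. (f x)\<^sup>2)"
  proof (rule finite_measure.integrable_const_bound[OF finite_measure_I01, where B = "B\<^sup>2"])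
    have "0 \<le> B" using assms(2)[of 0] by linarith
    then show "AE x in I01. norm ((f x)\<^sup>2) \<le> B\<^sup>2"
      using assms(2) by (intro AE_I2) (simp add: abs_le_square_iff[symmetric])
  qed (use assms(1) in auto)
  with assms(1) show ?thesis by (simp add: L2_def)
qed

lemma borel_measurable_slope [measurable]: "slope \<in> borel_measurable borel"
  using slope_has_derivative
  by (intro borel_measurable_continuous_onI) (rule DERIV_continuous_on)

lemma L2_slope: "f \<in> L2 \<Longrightarrow> (\<lambda>x. slope (f x)) \<in> L2"
  by (rule L2_bounded[OF measurable_compose[OF L2_measurable borel_measurable_slope] abs_slope_le])

section \<open>The mean-free primitive of the slope as an element of \<open>h1\<close>\<close>

lemma slope_primitive_indef_integral:
  "indef_integral (slope_primitive u) (\<lambda>x. slope (h1_deriv u x))"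
proof -
  let ?s = "\<lambda>x. slope (h1_deriv u x)"
  have ai: "?s absolutely_integrable_on {0..1}"
    using L2_integrable[OF L2_slope[OF h1_deriv_L2]] by (simp add: integrable_I01_iff)
  have eq: "slope_primitive u x = integral {0..x} ?s" if "x \<in> {0..1}" for x
  proof -
    have "?s absolutely_integrable_on {0<..<x}"
      using that by (intro set_integrable_subset[OF ai]) auto
    then have "integrable (lebesgue_on {0<..<x}) ?s"
      by (simp add: integrable_restrict_space set_integrable_def)
    from lebesgue_integral_eq_integral[OF this] show ?thesis
      using integral_open_interval_real[of 0 x ?s] by (simp add: slope_primitive_def slope_def)
  qed
  then have "slope_primitive u x - slope_primitive u 0 = integral {0..x} ?s" if "x \<in> {0..1}" for x
    using that by simp
  with ai show ?thesis by (simp add: indef_integral_def)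
qed

lemma gradient_fun_indef_integral:
  "indef_integral (gradient_fun \<sigma> u \<alpha>) (\<lambda>x. \<sigma> \<alpha> * slope (h1_deriv u x))"
proof -
  have "indef_integral (\<lambda>x. slope_primitive u x + c) (\<lambda>x. slope (h1_deriv u x))" for c
    using slope_primitive_indef_integral[of u] by (simp add: indef_integral_def)
  from indef_integral_scale[OF this[of "- (LINT z|I01. slope_primitive u z)"], of "\<sigma> \<alpha>"]
  show ?thesis by (simp add: gradient_fun_def[abs_def])
qed

lemma gradient_fun_H_per_ave_1:
  shows "gradient_fun \<sigma> u \<alpha> \<in> H_per_ave 1"
    and "AE x in I01. wderiv (gradient_fun \<sigma> u \<alpha>) x = \<sigma> \<alpha> * slope (h1_deriv u x)"
proof -
  have "(LINT x|I01. gradient_fun \<sigma> u \<alpha> x) = 0"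
    using Bochner_Integration.integral_diff[of I01 "slope_primitive u" "\<lambda>_. c" for c,
        OF L2_integrable[OF indef_integral_L2[OF slope_primitive_indef_integral[of u]]]
          L2_integrable[OF L2_const]]
    by (simp add: gradient_fun_def measure_restrict_space)
  note * = H_per_ave_1I[OF indef_integral_L2[OF gradient_fun_indef_integral]
      L2_scale[OF L2_slope[OF h1_deriv_L2]]
      indef_integral_weak_deriv_interval[OF gradient_fun_indef_integral] this]
  show "gradient_fun \<sigma> u \<alpha> \<in> H_per_ave 1"
    "AE x in I01. wderiv (gradient_fun \<sigma> u \<alpha>) x = \<sigma> \<alpha> * slope (h1_deriv u x)"
    using * by simp_all
qed

lemma h1_deriv_abs_gradient_fun:
  "AE x in I01. h1_deriv (abs_h1 (gradient_fun \<sigma> u \<alpha>)) x = \<sigma> \<alpha> * slope (h1_deriv u x)"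
proof -
  have "h1_rel (gradient_fun \<sigma> u \<alpha>) (gradient_fun \<sigma> u \<alpha>)"
    by (simp add: h1_rel_def gradient_fun_H_per_ave_1(1)[simplified])
  then show ?thesis using gradient_fun_H_per_ave_1(2) by (simp add: h1_deriv.abs_eq)
qed

text \<open>The reason for the explicit formula: the inner product pairs first derivatives, so a
  functional given by integration against \<open>h\<^sub>x\<close> is represented by a primitive of
  its kernel, normalized to mean zero.\<close>

lemma inner_abs_gradient_fun:
  "inner h (abs_h1 (gradient_fun \<sigma> u \<alpha>)) = \<sigma> \<alpha> * (LINT x|I01. slope (h1_deriv u x) * h1_deriv h x)"
proof -
  have m: "h1_deriv w \<in> borel_measurable I01" "(\<lambda>x. slope (h1_deriv w x)) \<in> borel_measurable I01" for w
    by (rule L2_measurable, rule h1_deriv_L2) (rule L2_measurable, rule L2_slope, rule h1_deriv_L2)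
  have "inner h (abs_h1 (gradient_fun \<sigma> u \<alpha>))
      = (LINT x|I01. \<sigma> \<alpha> * (slope (h1_deriv u x) * h1_deriv h x))"
    unfolding inner_h1_def
  proof (rule integral_cong_AE)
    show "AE x in I01. h1_deriv h x * h1_deriv (abs_h1 (gradient_fun \<sigma> u \<alpha>)) x
        = \<sigma> \<alpha> * (slope (h1_deriv u x) * h1_deriv h x)"
      using h1_deriv_abs_gradient_fun[of \<sigma> u \<alpha>] by eventually_elim simp
  qed (intro borel_measurable_times borel_measurable_const m)+
  then show ?thesis by simp
qed

section \<open>Differentiability of the length and of the energy\<close>

lemma integrable_curve_length:
  assumes "v \<in> L2"
  shows "integrable I01 (\<lambda>x. sqrt (1 + (v x)\<^sup>2))"
proof (rule Bochner_Integration.integrable_bound)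
  show "integrable I01 (\<lambda>x. 1 + (v x)\<^sup>2)"
    using assms L2_integrable[OF L2_const[of 1]] by (auto simp: L2_def)
  show "(\<lambda>x. sqrt (1 + (v x)\<^sup>2)) \<in> borel_measurable I01"
    using L2_measurable[OF assms] by measurable
  have "sqrt (1 + p\<^sup>2) \<le> 1 + p\<^sup>2" for p :: real
    by (rule real_le_lsqrt) (auto intro: self_le_power)
  then show "AE x in I01. norm (sqrt (1 + (v x)\<^sup>2)) \<le> norm (1 + (v x)\<^sup>2)"
    by (intro AE_I2) simp
qed

text \<open>The pointwise remainder bound integrates to a quadratic one with a constant independent
  of \<open>u\<close>. It serves twice: for the gradient of the length, and at \<open>u = 0\<close>
  for an upper bound of the length.\<close>

lemma curve_length_expansion:
  "\<bar>curve_length (u + h) - curve_length u - (LINT x|I01. slope (h1_deriv u x) * h1_deriv h x)\<bar>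
    \<le> (norm h)\<^sup>2 / 2"
proof -
  let ?p = "h1_deriv u" and ?q = "h1_deriv h" and ?r = "h1_deriv (u + h)"
  note L = h1_deriv_L2[of u] h1_deriv_L2[of h] h1_deriv_L2[of "u + h"]
  note m = L[THEN L2_measurable]
  let ?R = "\<lambda>x. sqrt (1 + (?p x + ?q x)\<^sup>2) - sqrt (1 + (?p x)\<^sup>2) - slope (?p x) * ?q x"
  have i: "integrable I01 (\<lambda>x. sqrt (1 + (?p x + ?q x)\<^sup>2))" "integrable I01 (\<lambda>x. sqrt (1 + (?p x)\<^sup>2))"
    "integrable I01 (\<lambda>x. slope (?p x) * ?q x)" "integrable I01 (\<lambda>x. (?q x)\<^sup>2 / 2)"
    using L by (auto intro!: integrable_curve_length L2_add L2_mult L2_slope) (auto simp: L2_def)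
  have "curve_length (u + h) = (LINT x|I01. sqrt (1 + (?p x + ?q x)\<^sup>2))"
    unfolding curve_length_def
  proof (rule integral_cong_AE)
    show "AE x in I01. sqrt (1 + \<bar>?r x\<bar>\<^sup>2) = sqrt (1 + (?p x + ?q x)\<^sup>2)"
      using h1_deriv_add[of u h] by eventually_elim simp
  qed (use m in measurable)
  then have "curve_length (u + h) - curve_length u - (LINT x|I01. slope (?p x) * ?q x) = (LINT x|I01. ?R x)"
    using i by (simp add: curve_length_def)
  moreover have "\<bar>LINT x|I01. ?R x\<bar> \<le> (LINT x|I01. (?q x)\<^sup>2 / 2)"
    using sqrt_one_plus_square_expansion i
    by (intro integral_abs_bound_integral) auto
  moreover have "(LINT x|I01. (?q x)\<^sup>2 / 2) = (norm h)\<^sup>2 / 2"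
    by (simp add: dot_square_norm[symmetric] inner_h1_def power2_eq_square[of "h1_deriv h _"])
  ultimately show ?thesis by simp
qed

text \<open>The length is the energy for the constant weight 1, which explains
  \<open>\<lambda>_. 1\<close>; the parameter 0 is a dummy.\<close>

lemma curve_length_gradient:
  "GDERIV curve_length u :> abs_h1 (gradient_fun (\<lambda>_. 1) u 0)"
proof -
  let ?S = "abs_h1 (gradient_fun (\<lambda>_. 1) u 0)"
  have "((\<lambda>v. norm (curve_length v - curve_length u - inner (v - u) ?S) / norm (v - u)) \<longlongrightarrow> 0) (at u)"
  proof (rule Lim_null_comparison)
    show "\<forall>\<^sub>F v in at u. norm (norm (curve_length v - curve_length u - inner (v - u) ?S) / norm (v - u))
        \<le> norm (v - u) / 2"
    proof (rule always_eventually, rule allI)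
      fix v
      have "\<bar>curve_length v - curve_length u - inner (v - u) ?S\<bar> \<le> (norm (v - u))\<^sup>2 / 2"
        using curve_length_expansion[of u "v - u"] by (simp add: inner_abs_gradient_fun)
      then show "norm (norm (curve_length v - curve_length u - inner (v - u) ?S) / norm (v - u))
          \<le> norm (v - u) / 2"
        by (cases "v = u") (simp_all add: divide_le_eq power2_eq_square)
    qed
    show "((\<lambda>v. norm (v - u) / 2) \<longlongrightarrow> 0) (at u)"
      by (auto intro!: tendsto_eq_intros)
  qed
  then show ?thesis
    unfolding gderiv_def has_derivative_iff_norm
    by (simp add: bounded_linear_inner_left)
qed

lemma energy_gradient:
  assumes "(\<sigma> has_real_derivative deriv \<sigma> \<alpha>) (at \<alpha>)"
  shows "GDERIV (energy \<sigma>) (u, \<alpha>) :>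
    (abs_h1 (gradient_fun \<sigma> u \<alpha>), deriv \<sigma> \<alpha> * curve_length u)"
proof -
  let ?S = "abs_h1 (gradient_fun (\<lambda>_. 1) u 0)"
  have "((\<lambda>p :: X. \<sigma> (snd p)) has_derivative (\<lambda>h. deriv \<sigma> \<alpha> * snd h)) (at (u, \<alpha>))"
    by (rule has_derivative_compose[of snd snd _ _ \<sigma> "(*) (deriv \<sigma> \<alpha>)"])
      (use assms in \<open>auto simp: has_field_derivative_def intro!: derivative_eq_intros\<close>)
  moreover have "((\<lambda>p :: X. curve_length (fst p)) has_derivative (\<lambda>h. inner (fst h) ?S)) (at (u, \<alpha>))"
    by (rule has_derivative_compose[of fst fst _ _ curve_length "\<lambda>h. inner h ?S"])
      (use curve_length_gradient[of u] in \<open>auto simp: gderiv_def intro!: derivative_eq_intros\<close>)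
  ultimately have "((\<lambda>p. \<sigma> (snd p) * curve_length (fst p)) has_derivative
      (\<lambda>h. \<sigma> (snd (u, \<alpha>)) * inner (fst h) ?S + deriv \<sigma> \<alpha> * snd h * curve_length (fst (u, \<alpha>)))) (at (u, \<alpha>))"
    by (rule has_derivative_mult)
  moreover have "\<sigma> (snd (u, \<alpha>)) * inner (fst h) ?S + deriv \<sigma> \<alpha> * snd h * curve_length (fst (u, \<alpha>))
      = inner h (abs_h1 (gradient_fun \<sigma> u \<alpha>), deriv \<sigma> \<alpha> * curve_length u)" for h
    by (cases h) (simp add: inner_abs_gradient_fun)
  ultimately show ?thesis
    by (simp add: gderiv_def energy_def[abs_def])
qed

lemma GDERIV_unique:
  assumes "GDERIV F p :> D" "GDERIV F p :> D'"
  shows "D = D'"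
proof -
  have "(\<lambda>h. inner h D) = (\<lambda>h. inner h D')"
    using assms unfolding gderiv_def by (rule has_derivative_unique)
  then have "\<forall>h. inner h D = inner h D'" by (simp add: fun_eq_iff)
  then show ?thesis by (simp only: vector_eq_ldot)
qed

lemma gradientI: "GDERIV F p :> D \<Longrightarrow> gradient F p = D"
  unfolding gradient_def by (rule the_equality) (auto intro: GDERIV_unique)


section \<open>Estimates in the norm of \<open>Y\<close>\<close>

lemma in_H2_per_ave_iff:
  "in_H2_per_ave u \<longleftrightarrow>
     (\<exists>V w. w \<in> L2 \<and> indef_integral V w \<and> V 0 = V 1 \<and> (AE x in I01. h1_deriv u x = V x))"
  by transfer (simp add: h1_rel_def H_per_ave_2_iff)

text \<open>\<open>norm_Y\<close> measures the second derivative fixed by \<open>wderiv\<close>, so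
  the density \<open>w\<close> of the characterization is used only to see that a weak derivative
  exists; the representative is then rebuilt from \<open>h1_deriv2 u\<close>.\<close>

lemma h1_deriv2_indef_integral:
  assumes "in_H2_per_ave u"
  obtains V where "h1_deriv2 u \<in> L2" "indef_integral V (h1_deriv2 u)" "AE x in I01. h1_deriv u x = V x"
proof -
  obtain V w where V: "w \<in> L2" "indef_integral V w" "AE x in I01. h1_deriv u x = V x"
    using assms in_H2_per_ave_iff by blast
  have wd: "weak_deriv_interval (h1_deriv u) w"
    using weak_deriv_cong[OF h1_deriv_L2 indef_integral_L2[OF V(2)] V(3)]
      indef_integral_weak_deriv_interval[OF V(2)] by simp
  have "wderiv (h1_deriv u) \<in> L2 \<and> weak_deriv_interval (h1_deriv u) (wderiv (h1_deriv u))"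
    unfolding wderiv_def[of "h1_deriv u"] by (rule someI[of _ w]) (use V(1) wd in simp)
  \<comment> \<open>Both lifted functions act on the same chosen representative of the class, so
    unfolding suffices.\<close>
  moreover have "h1_deriv2 u = wderiv (h1_deriv u)"
    by (simp add: h1_deriv2_def h1_deriv_def)
  ultimately have d2: "h1_deriv2 u \<in> L2" "weak_deriv_interval (h1_deriv u) (h1_deriv2 u)"
    by simp_all
  obtain W where "indef_integral W (h1_deriv2 u)" "AE x in I01. h1_deriv u x = W x"
    using weak_deriv_interval_imp_indef_integral[OF h1_deriv_L2 d2] .
  with d2(1) show thesis by (rule that)
qed

lemma abs_slope'_le: "\<bar>slope' p\<bar> \<le> 1"
proof -
  have "1 * 1 \<le> (1 + p\<^sup>2) * sqrt (1 + p\<^sup>2)" by (intro mult_mono) auto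
  then show ?thesis by (simp add: slope'_def)
qed

lemma L2_bounded_times:
  assumes "f \<in> L2" "g \<in> borel_measurable I01" "\<And>x. \<bar>g x\<bar> \<le> 1"
  shows "(\<lambda>x. g x * f x) \<in> L2"
proof -
  have "integrable I01 (\<lambda>x. (g x * f x)\<^sup>2)"
  proof (rule Bochner_Integration.integrable_bound)
    show "integrable I01 (\<lambda>x. (f x)\<^sup>2)" using assms(1) by (simp add: L2_def)
    have "(g x)\<^sup>2 \<le> 1" for x using assms(3)[of x] by (simp add: abs_square_le_1)
    then show "AE x in I01. norm ((g x * f x)\<^sup>2) \<le> norm ((f x)\<^sup>2)"
      by (intro AE_I2) (simp add: power_mult_distrib mult_left_le_one_le)
  qed (use assms(2) L2_measurable[OF assms(1)] in measurable)
  with assms(2) L2_measurable[OF assms(1)] show ?thesis by (simp add: L2_def)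
qed

text \<open>The chain rule for \<open>slope\<close> supplies the second derivative, boundedness of
  \<open>slope'\<close> keeps it square integrable, and equal end values of \<open>V\<close> give
  equal end values of \<open>slope (V x)\<close>.\<close>

lemma in_H2_per_ave_gradient_fun:
  assumes "in_H2_per_ave u"
  shows "in_H2_per_ave (abs_h1 (gradient_fun \<sigma> u \<alpha>))"
proof -
  obtain V w where V: "w \<in> L2" "indef_integral V w" "V 0 = V 1" "AE x in I01. h1_deriv u x = V x"
    using assms in_H2_per_ave_iff by blast
  define W where "W x = \<sigma> \<alpha> * slope (V x)" for x
  define d where "d x = \<sigma> \<alpha> * (slope' (V x) * w x)" for x
  have "indef_integral W d"
    unfolding W_def d_def
    by (intro indef_integral_scale indef_integral_chain V(2) slope_has_derivative continuous_slope')
  moreover have "d \<in> L2"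
    unfolding d_def
    using measurable_compose[OF L2_measurable[OF indef_integral_L2[OF V(2)]]
        borel_measurable_continuous_onI[OF continuous_slope']] abs_slope'_le
    by (intro L2_scale L2_bounded_times V(1))
  moreover have "W 0 = W 1" using V(3) by (simp add: W_def)
  moreover have "AE x in I01. h1_deriv (abs_h1 (gradient_fun \<sigma> u \<alpha>)) x = W x"
    using V(4) h1_deriv_abs_gradient_fun[of \<sigma> u \<alpha>] by eventually_elim (simp add: W_def)
  ultimately show ?thesis using in_H2_per_ave_iff by blast
qed

text \<open>The one-dimensional Sobolev embedding: the oscillation of \<open>A\<close> is at most
  the integral of \<open>\<bar>a\<bar>\<close>, so \<open>\<bar>A x\<bar>\<close> minus this
  integral is below every \<open>\<bar>A y\<bar>\<close>; then average over
  \<open>y\<close>.\<close>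

lemma indef_integral_sup_bound:
  assumes A: "indef_integral A a" and x: "x \<in> {0..1}"
  shows "\<bar>A x\<bar> \<le> (LINT y|I01. \<bar>A y\<bar>) + (LINT y|I01. \<bar>a y\<bar>)"
proof -
  let ?I = "LINT y|I01. \<bar>a y\<bar>"
  have ia: "integrable I01 (\<lambda>y. \<bar>a y\<bar>)" and iA: "integrable I01 (\<lambda>y. \<bar>A y\<bar>)"
    using A L2_integrable[OF indef_integral_L2[OF A]]
    by (auto simp: indef_integral_def integrable_I01_iff[symmetric])
  have an: "(\<lambda>t. \<bar>a t\<bar>) integrable_on {s..t}" if "0 \<le> s" "t \<le> 1" for s t
    using indef_integral_subinterval[OF A that] by (auto simp: absolutely_integrable_on_def)
  have osc: "\<bar>A t - A s\<bar> \<le> ?I" if st: "0 \<le> s" "s \<le> t" "t \<le> 1" for s t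
  proof -
    have "a integrable_on {s..t}"
      using indef_integral_subinterval[OF A, of s t] st by (simp add: absolutely_integrable_on_def)
    then have "norm (integral {s..t} a) \<le> integral {s..t} (\<lambda>t. \<bar>a t\<bar>)"
      using an[of s t] st by (intro integral_norm_bound_integral) auto
    also have "\<dots> \<le> integral {0..1} (\<lambda>t. \<bar>a t\<bar>)"
      using st by (intro integral_subset_le an) auto
    finally show ?thesis
      using indef_integral_diff[OF A st] integral_I01_eq[OF ia] by simp
  qed
  have "\<bar>A x\<bar> - ?I = (LINT y|I01. \<bar>A x\<bar> - ?I)" by (simp only: integral_I01_const)
  also have "\<dots> \<le> (LINT y|I01. \<bar>A y\<bar>)"
  proof (rule integral_mono[OF _ iA])
    show "integrable I01 (\<lambda>y. \<bar>A x\<bar> - ?I)" by (rule L2_integrable[OF L2_const])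
    fix y assume "y \<in> space I01"
    then show "\<bar>A x\<bar> - ?I \<le> \<bar>A y\<bar>"
      using osc[of x y] osc[of y x] x by (cases "x \<le> y") auto
  qed
  finally show ?thesis by simp
qed

text \<open>Expanding \<open>(\<bar>f x\<bar> - 1 / 2)\<^sup>2 \<ge> 0\<close> replaces the
  Cauchy--Schwarz inequality at this particular size.\<close>

lemma L2_abs_integral_le:
  assumes "f \<in> L2" "(LINT x|I01. (f x)\<^sup>2) \<le> 1 / 4"
  shows "(LINT x|I01. \<bar>f x\<bar>) \<le> 1 / 2"
proof -
  have "(LINT x|I01. \<bar>f x\<bar>) \<le> (LINT x|I01. (f x)\<^sup>2 + 1 / 4)"
  proof (rule integral_mono)
    show "\<bar>f x\<bar> \<le> (f x)\<^sup>2 + 1 / 4" for x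
      using zero_le_power2[of "\<bar>f x\<bar> - 1 / 2"] by (simp add: power2_diff power2_eq_square[of "1 / 2"])
  qed (use assms(1) L2_integrable[OF assms(1)] L2_integrable[OF L2_const] in \<open>auto simp: L2_def\<close>)
  also have "\<dots> = (LINT x|I01. (f x)\<^sup>2) + 1 / 4"
    using assms(1) L2_integrable[OF L2_const] by (simp add: L2_def measure_restrict_space)
  finally show ?thesis using assms(2) by simp
qed

lemma norm_Y_square:
  "(norm_Y p)\<^sup>2 = (LINT x|I01. (h1_deriv (fst p) x)\<^sup>2) + (LINT x|I01. (h1_deriv2 (fst p) x)\<^sup>2) + (snd p)\<^sup>2"
  by (simp add: norm_Y_def inner_Y_def power2_eq_square)

text \<open>The radius \<open>1 / 2\<close> makes both square integrals at most
  \<open>1 / 4\<close>, hence both integrals of absolute values at most \<open>1 / 2\<close>, and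
  these add up to 1 in the sup bound.\<close>

lemma small_norm_Y_imp_deriv_le:
  assumes "in_H2_per_ave u" "norm_Y (u, \<beta>) \<le> 1 / 2"
  shows "AE x in I01. \<bar>h1_deriv u x\<bar> \<le> 1"
proof -
  obtain V where V: "h1_deriv2 u \<in> L2" "indef_integral V (h1_deriv2 u)"
    "AE x in I01. h1_deriv u x = V x"
    using h1_deriv2_indef_integral[OF assms(1)] .
  have "(norm_Y (u, \<beta>))\<^sup>2 \<le> (1 / 2)\<^sup>2"
    using assms(2) by (intro power_mono) (simp_all add: norm_Y_def inner_Y_def)
  moreover have "0 \<le> (LINT x|I01. (h1_deriv u x)\<^sup>2)" "0 \<le> (LINT x|I01. (h1_deriv2 u x)\<^sup>2)" "0 \<le> \<beta>\<^sup>2" by simp_all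
  moreover have "(1 / 2 :: real)\<^sup>2 = 1 / 4" by (simp add: power2_eq_square)
  ultimately have le: "(LINT x|I01. (h1_deriv u x)\<^sup>2) \<le> 1 / 4" "(LINT x|I01. (h1_deriv2 u x)\<^sup>2) \<le> 1 / 4"
    unfolding norm_Y_square fst_conv snd_conv by linarith+
  have "(LINT x|I01. (V x)\<^sup>2) = (LINT x|I01. (h1_deriv u x)\<^sup>2)"
    using V(3) L2_measurable[OF h1_deriv_L2[of u]] L2_measurable[OF indef_integral_L2[OF V(2)]]
    by (intro integral_cong_AE) (auto elim: eventually_mono)
  then have V2: "(LINT x|I01. (V x)\<^sup>2) \<le> 1 / 4" using le(1) by (rule ord_eq_le_trans)
  have "\<bar>V x\<bar> \<le> 1" if "x \<in> {0..1}" for x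
    using indef_integral_sup_bound[OF V(2) that] L2_abs_integral_le[OF V(1) le(2)]
      L2_abs_integral_le[OF indef_integral_L2[OF V(2)] V2] by linarith
  then have "AE x in I01. \<bar>V x\<bar> \<le> 1" by (intro AE_I2) simp
  with V(3) show ?thesis by eventually_elim simp
qed

section \<open>Bounds for the length and for the gradient norm\<close>

lemma curve_length_ge_1: "1 \<le> curve_length u"
proof -
  have "(LINT x|I01. (1::real)) \<le> curve_length u"
    unfolding curve_length_def
    using integrable_curve_length[OF h1_deriv_L2[of u]] L2_integrable[OF L2_const]
    by (intro integral_mono) auto
  then show ?thesis by (simp only: integral_I01_const)
qed

lemma curve_length_le: "curve_length u \<le> 1 + (norm u)\<^sup>2 / 2"
proof -
  have "curve_length 0 = 1"
  proof -
    \<comment> \<open>The derivative of the zero class is a chosen version, known to vanish only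
      almost everywhere; this is seen by writing 0 as \<open>0 *\<^sub>R u\<close>.\<close>
    have "AE x in I01. h1_deriv (0 *\<^sub>R u) x = 0" using h1_deriv_scale[of 0 u] by simp
    then have "curve_length 0 = (LINT x|I01. 1)"
      unfolding curve_length_def using L2_measurable[OF h1_deriv_L2[of 0]]
      by (intro integral_cong_AE) (auto elim: eventually_mono)
    then show ?thesis by (simp only: integral_I01_const)
  qed
  moreover have "(LINT x|I01. slope (h1_deriv 0 x) * h1_deriv u x) = 0"
  proof (rule integral_eq_zero_AE)
    have "AE x in I01. h1_deriv (0 *\<^sub>R u) x = 0" using h1_deriv_scale[of 0 u] by simp
    then show "AE x in I01. slope (h1_deriv 0 x) * h1_deriv u x = 0"
      by eventually_elim (simp add: slope_def)
  qed
  ultimately show ?thesis using curve_length_expansion[of 0 u] unfolding add_0_left by linarith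
qed

lemma norm_abs_gradient_fun:
  "(norm (abs_h1 (gradient_fun \<sigma> u \<alpha>)))\<^sup>2 = (\<sigma> \<alpha>)\<^sup>2 * (LINT x|I01. (slope (h1_deriv u x))\<^sup>2)"
proof -
  let ?G = "abs_h1 (gradient_fun \<sigma> u \<alpha>)"
  have "(norm ?G)\<^sup>2 = \<sigma> \<alpha> * (LINT x|I01. slope (h1_deriv u x) * h1_deriv ?G x)"
    by (simp only: power2_norm_eq_inner inner_abs_gradient_fun)
  also have "(LINT x|I01. slope (h1_deriv u x) * h1_deriv ?G x)
      = (LINT x|I01. \<sigma> \<alpha> * (slope (h1_deriv u x))\<^sup>2)"
  proof (rule integral_cong_AE)
    show "AE x in I01. slope (h1_deriv u x) * h1_deriv ?G x = \<sigma> \<alpha> * (slope (h1_deriv u x))\<^sup>2"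
      using h1_deriv_abs_gradient_fun[of \<sigma> u \<alpha>] by eventually_elim (simp add: power2_eq_square)
  qed (use L2_measurable[OF h1_deriv_L2[of u]] L2_measurable[OF h1_deriv_L2[of ?G]] in measurable)
  finally show ?thesis by (simp add: power2_eq_square)
qed

text \<open>For \<open>\<bar>p\<bar> \<le> 1\<close> the square of the slope,
  \<open>p\<^sup>2 / (1 + p\<^sup>2)\<close>, is at least \<open>p\<^sup>2 / 2\<close>. This is
  where the pointwise bound, and with it the topology of \<open>Y\<close>, enters.\<close>

lemma norm_abs_gradient_fun_ge:
  assumes "AE x in I01. \<bar>h1_deriv u x\<bar> \<le> 1"
  shows "(\<sigma> \<alpha>)\<^sup>2 * ((norm u)\<^sup>2 / 2) \<le> (norm (abs_h1 (gradient_fun \<sigma> u \<alpha>)))\<^sup>2"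
proof -
  have "(norm u)\<^sup>2 / 2 = (LINT x|I01. (h1_deriv u x)\<^sup>2 / 2)"
    by (simp add: dot_square_norm[symmetric] inner_h1_def power2_eq_square[of "h1_deriv u _"])
  also have "\<dots> \<le> (LINT x|I01. (slope (h1_deriv u x))\<^sup>2)"
  proof (rule integral_mono_AE)
    show "integrable I01 (\<lambda>x. (h1_deriv u x)\<^sup>2 / 2)" "integrable I01 (\<lambda>x. (slope (h1_deriv u x))\<^sup>2)"
      using h1_deriv_L2[of u] L2_slope[OF h1_deriv_L2[of u]] by (auto simp: L2_def)
    show "AE x in I01. (h1_deriv u x)\<^sup>2 / 2 \<le> (slope (h1_deriv u x))\<^sup>2"
      using assms
    proof eventually_elim
      case (elim x)
      then have "(h1_deriv u x)\<^sup>2 \<le> 1" by (simp add: abs_square_le_1)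
      then show ?case unfolding slope_square by (intro divide_left_mono) (auto simp: add_pos_nonneg)
    qed
  qed
  finally show ?thesis unfolding norm_abs_gradient_fun by (rule mult_left_mono) simp
qed

lemma norm_Y_ge:
  "norm (fst p) \<le> norm_Y p" "\<bar>snd p\<bar> \<le> norm_Y p"
proof -
  have n: "(norm (fst p))\<^sup>2 = (LINT x|I01. (h1_deriv (fst p) x)\<^sup>2)"
    by (simp add: dot_square_norm[symmetric] inner_h1_def power2_eq_square[of "h1_deriv _ _"])
  have nn: "0 \<le> (LINT x|I01. (h1_deriv2 (fst p) x)\<^sup>2)" "0 \<le> (LINT x|I01. (h1_deriv (fst p) x)\<^sup>2)" by simp_all
  have "0 \<le> norm_Y p" by (simp add: norm_Y_def inner_Y_def)
  moreover have "(norm (fst p))\<^sup>2 \<le> (norm_Y p)\<^sup>2" "\<bar>snd p\<bar>\<^sup>2 \<le> (norm_Y p)\<^sup>2"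
    unfolding norm_Y_square n using nn by (simp_all add: add_nonneg_nonneg)
  ultimately show "norm (fst p) \<le> norm_Y p" "\<bar>snd p\<bar> \<le> norm_Y p"
    by (auto intro: power2_le_imp_le)
qed

section \<open>Critical points and the assembly of the inequality\<close>

lemma critical_point_energy:
  assumes \<sigma>: "(\<sigma> has_real_derivative deriv \<sigma> \<alpha>) (at \<alpha>)" "\<sigma> \<alpha> \<noteq> 0"
    and "critical_point (energy \<sigma>) (u, \<alpha>)"
  shows "u = 0" "deriv \<sigma> \<alpha> = 0"
proof -
  have "(abs_h1 (gradient_fun \<sigma> u \<alpha>), deriv \<sigma> \<alpha> * curve_length u) = 0"
    using GDERIV_unique[OF energy_gradient[OF \<sigma>(1)]] assms(3) by (simp add: critical_point_def)
  then have *: "abs_h1 (gradient_fun \<sigma> u \<alpha>) = 0" "deriv \<sigma> \<alpha> * curve_length u = 0"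
    by (simp_all add: zero_prod_def)
  show "deriv \<sigma> \<alpha> = 0" using *(2) curve_length_ge_1[of u] by auto
  have "(LINT x|I01. (slope (h1_deriv u x))\<^sup>2) = 0"
    using norm_abs_gradient_fun[of \<sigma> u \<alpha>] *(1) \<sigma>(2) by simp
  moreover have "integrable I01 (\<lambda>x. (slope (h1_deriv u x))\<^sup>2)"
    using L2_slope[OF h1_deriv_L2[of u]] by (simp add: L2_def)
  ultimately have "AE x in I01. (slope (h1_deriv u x))\<^sup>2 = 0"
    by (simp add: integral_nonneg_eq_0_iff_AE)
  \<comment> \<open>\<open>slope\<close> vanishes only at 0.\<close>
  then have "AE x in I01. h1_deriv u x * h1_deriv u x = 0"
    by eventually_elim (simp add: slope_eq_0_iff)
  then have "inner u u = 0"
    unfolding inner_h1_def by (rule integral_eq_zero_AE)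
  then show "u = 0" by simp
qed

text \<open>To be read with \<open>D\<close> the squared norm of \<open>u\<close>, \<open>N\<close>
  the gradient norm, \<open>\<delta>\<close> the change of \<open>\<sigma>\<close> and
  \<open>\<Delta>\<close> the energy difference. Up to a factor 2 the larger summand bounds
  \<open>\<Delta>\<close>, so the power is applied to one summand at a time. The first would allow
  the exponent \<open>1 / 2\<close>; since \<open>D \<le> 1\<close>, the exponent
  \<open>1 - \<theta> \<ge> 1 / 2\<close> only decreases its power.\<close>

lemma lojasiewicz_combine:
  fixes D N M c0 C1 \<delta> \<Delta> \<theta> :: real
  assumes "0 \<le> D" "D \<le> 1" "0 \<le> N" "0 < M" "0 < c0" "0 < C1" "0 < \<theta>" "\<theta> \<le> 1 / 2"
    and N: "c0\<^sup>2 * (D / 2) \<le> N\<^sup>2" "C1 * \<delta> powr (1 - \<theta>) \<le> N"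
    and \<Delta>: "0 \<le> \<Delta>" "\<Delta> \<le> M * (D / 2) + \<delta>" "0 \<le> \<delta>"
  shows "\<Delta> powr (1 - \<theta>) \<le> (M powr (1 - \<theta>) * sqrt 2 / c0 + 2 powr (1 - \<theta>) / C1) * N"
proof -
  have "(M * D) powr (1 - \<theta>) = M powr (1 - \<theta>) * D powr (1 - \<theta>)"
    using assms by (simp add: powr_mult)
  also have "D powr (1 - \<theta>) \<le> D powr (1 / 2)"
    using assms by (intro powr_mono') auto
  also have "D powr (1 / 2) = sqrt D" using assms by (simp add: powr_half_sqrt)
  also have "sqrt D \<le> sqrt 2 / c0 * N"
  proof (rule real_le_lsqrt)
    have "D * c0\<^sup>2 \<le> 2 * N\<^sup>2" using N(1) by (simp add: field_simps)
    then show "D \<le> (sqrt 2 / c0 * N)\<^sup>2"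
      using assms by (simp add: power_mult_distrib power_divide pos_le_divide_eq)
  qed (use assms in auto)
  finally have 1: "(M * D) powr (1 - \<theta>) \<le> M powr (1 - \<theta>) * sqrt 2 / c0 * N"
    by (simp add: mult_left_mono)
  have "(2 * \<delta>) powr (1 - \<theta>) = 2 powr (1 - \<theta>) * \<delta> powr (1 - \<theta>)"
    using assms by (simp add: powr_mult)
  also have "\<dots> \<le> 2 powr (1 - \<theta>) * (N / C1)"
    using N(2) assms by (intro mult_left_mono) (auto simp: pos_le_divide_eq mult.commute)
  finally have 2: "(2 * \<delta>) powr (1 - \<theta>) \<le> 2 powr (1 - \<theta>) / C1 * N" by simp
  have "\<Delta> \<le> M * D \<or> \<Delta> \<le> 2 * \<delta>" using \<Delta> by linarith
  then have "\<Delta> powr (1 - \<theta>) \<le> (M * D) powr (1 - \<theta>) \<or> \<Delta> powr (1 - \<theta>) \<le> (2 * \<delta>) powr (1 - \<theta>)"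
    using \<Delta>(1) assms by (auto intro: powr_mono2)
  moreover have "0 \<le> (M * D) powr (1 - \<theta>)" "0 \<le> (2 * \<delta>) powr (1 - \<theta>)" by simp_all
  ultimately have "\<Delta> powr (1 - \<theta>) \<le> (M * D) powr (1 - \<theta>) + (2 * \<delta>) powr (1 - \<theta>)" by linarith
  with 1 2 show ?thesis unfolding distrib_right by linarith
qed

text \<open>The first two conjuncts give the inequality its meaning: the explicit formula defines a
  genuine element of \<open>h1\<close> and is the gradient in \<open>X\<close>, and the gradient
  maps \<open>Y\<close> into itself, so that \<open>norm_Y\<close> applies to it.\<close>

theorem theorem2p4:
  fixes \<sigma> :: "real \<Rightarrow> real" and u_bar :: h1 and \<alpha>_bar :: real
  assumes "real_analytic \<sigma>"
    and "\<exists>c0>0. \<forall>\<alpha>. \<sigma> \<alpha> \<ge> c0"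
    and "(u_bar, \<alpha>_bar) \<in> Y"
    and "critical_point (energy \<sigma>) (u_bar, \<alpha>_bar)"
  shows
    "(\<forall>u \<alpha>. gradient_fun \<sigma> u \<alpha> \<in> H_per_ave 1 \<and>
        (GDERIV (energy \<sigma>) (u, \<alpha>) :>
           (abs_h1 (gradient_fun \<sigma> u \<alpha>), deriv \<sigma> \<alpha> * curve_length u))) \<and>
     (\<forall>p\<in>Y. gradient (energy \<sigma>) p \<in> Y) \<and>
     (\<exists>U \<theta> C. nbhd_Y U (u_bar, \<alpha>_bar) \<and> 0 < \<theta> \<and> \<theta> \<le> 1 / 2 \<and> C > 0 \<and>
        (\<forall>(u, \<alpha>)\<in>U.
           norm_Y (gradient (energy \<sigma>) (u, \<alpha>))
             \<ge> C * \<bar>energy \<sigma> (u, \<alpha>) - energy \<sigma> (u_bar, \<alpha>_bar)\<bar> powr (1 - \<theta>)))"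
proof -
  have d\<sigma>: "(\<sigma> has_real_derivative deriv \<sigma> \<alpha>) (at \<alpha>)" for \<alpha>
    using assms(1) by (rule real_analytic_has_derivative)
  obtain c0 where c0: "0 < c0" "\<And>\<alpha>. c0 \<le> \<sigma> \<alpha>" using assms(2) by blast
  have "\<sigma> \<alpha>_bar \<noteq> 0" using c0(1) c0(2)[of \<alpha>_bar] by linarith
  note crit = critical_point_energy[OF d\<sigma> this assms(4)]
  have grad: "gradient (energy \<sigma>) (u, \<alpha>) = (abs_h1 (gradient_fun \<sigma> u \<alpha>), deriv \<sigma> \<alpha> * curve_length u)"
    for u \<alpha> by (rule gradientI[OF energy_gradient[OF d\<sigma>]])
  obtain r \<theta> C1 where loj: "0 < r" "0 < \<theta>" "\<theta> \<le> 1 / 2" "0 < C1"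
    "\<And>\<alpha>. \<bar>\<alpha> - \<alpha>_bar\<bar> < r \<Longrightarrow> C1 * \<bar>\<sigma> \<alpha> - \<sigma> \<alpha>_bar\<bar> powr (1 - \<theta>) \<le> \<bar>deriv \<sigma> \<alpha>\<bar>"
    using lojasiewicz_real[OF assms(1) crit(2)] by blast
  \<comment> \<open>The assumed bound on \<open>\<sigma>\<close> is only from below; continuity
    supplies the local upper bound \<open>M\<close>.\<close>
  have "\<sigma> \<midarrow>\<alpha>_bar\<rightarrow> \<sigma> \<alpha>_bar" using DERIV_isCont[OF d\<sigma>] by (simp add: isCont_def)
  then have "\<forall>\<^sub>F \<alpha> in at \<alpha>_bar. \<sigma> \<alpha> < \<sigma> \<alpha>_bar + 1" by (rule order_tendstoD) simp
  then obtain s where s: "0 < s" "\<And>\<alpha>. \<alpha> \<noteq> \<alpha>_bar \<Longrightarrow> \<bar>\<alpha> - \<alpha>_bar\<bar> < s \<Longrightarrow> \<sigma> \<alpha> < \<sigma> \<alpha>_bar + 1"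
    by (auto simp: eventually_at dist_real_def)
  define M where "M = \<sigma> \<alpha>_bar + 1"
  have M: "0 < M" using c0(1) c0(2)[of \<alpha>_bar] by (simp add: M_def)
  \<comment> \<open>The three radii secure \<open>\<bar>u\<^sub>x\<bar> \<le> 1\<close>, the
    one-variable inequality, and the bound of \<open>\<sigma>\<close> by \<open>M\<close>.\<close>
  define \<rho> where "\<rho> = min (1 / 2) (min r s)"
  define U where "U = {q \<in> Y. norm_Y (q - (u_bar, \<alpha>_bar)) < \<rho>}"
  define K where "K = M powr (1 - \<theta>) * sqrt 2 / c0 + 2 powr (1 - \<theta>) / C1"
  have K: "0 < K" unfolding K_def using M c0(1) loj(4) by (intro add_pos_pos) auto
  have "0 < \<rho>" using loj(1) s(1) by (simp add: \<rho>_def)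
  then have U: "nbhd_Y U (u_bar, \<alpha>_bar)"
    using assms(3) unfolding nbhd_Y_def U_def by blast
  have main: "1 / K * \<bar>energy \<sigma> (u, \<alpha>) - energy \<sigma> (u_bar, \<alpha>_bar)\<bar> powr (1 - \<theta>)
      \<le> norm_Y (gradient (energy \<sigma>) (u, \<alpha>))" if "(u, \<alpha>) \<in> U" for u \<alpha>
  proof -
    \<comment> \<open>As \<open>u_bar = 0\<close>, the difference to the critical point has first
      component \<open>u\<close> itself.\<close>
    have u: "in_H2_per_ave u" and small: "norm_Y (u, \<alpha> - \<alpha>_bar) < \<rho>"
      using that by (auto simp: U_def Y_def crit(1))
    have nu: "norm u < 1 / 2" and \<alpha>: "\<bar>\<alpha> - \<alpha>_bar\<bar> < r" "\<bar>\<alpha> - \<alpha>_bar\<bar> < s"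
      using norm_Y_ge[of "(u, \<alpha> - \<alpha>_bar)"] small by (auto simp: \<rho>_def)
    have bd: "AE x in I01. \<bar>h1_deriv u x\<bar> \<le> 1"
      using small by (intro small_norm_Y_imp_deriv_le[OF u, of "\<alpha> - \<alpha>_bar"]) (simp add: \<rho>_def)
    define N where "N = norm_Y (gradient (energy \<sigma>) (u, \<alpha>))"
    have NG: "norm (abs_h1 (gradient_fun \<sigma> u \<alpha>)) \<le> N" and Nd: "\<bar>deriv \<sigma> \<alpha> * curve_length u\<bar> \<le> N"
      using norm_Y_ge[of "gradient (energy \<sigma>) (u, \<alpha>)"] by (simp_all add: grad N_def)
    have "c0\<^sup>2 * ((norm u)\<^sup>2 / 2) \<le> (\<sigma> \<alpha>)\<^sup>2 * ((norm u)\<^sup>2 / 2)"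
      using c0(1) c0(2)[of \<alpha>] by (intro mult_right_mono power_mono) auto
    also have "\<dots> \<le> N\<^sup>2"
      using norm_abs_gradient_fun_ge[OF bd] power_mono[OF NG, of 2] by (rule order_trans) simp
    finally have 1: "c0\<^sup>2 * ((norm u)\<^sup>2 / 2) \<le> N\<^sup>2" .
    \<comment> \<open>A length of at least 1 lets the second gradient component dominate
      \<open>\<bar>deriv \<sigma> \<alpha>\<bar>\<close>.\<close>
    have "\<bar>deriv \<sigma> \<alpha>\<bar> * 1 \<le> \<bar>deriv \<sigma> \<alpha>\<bar> * curve_length u"
      using curve_length_ge_1 by (intro mult_left_mono) auto
    then have 2: "C1 * \<bar>\<sigma> \<alpha> - \<sigma> \<alpha>_bar\<bar> powr (1 - \<theta>) \<le> N"
      using loj(5)[OF \<alpha>(1)] Nd curve_length_ge_1[of u] by (simp add: abs_mult)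
    have \<sigma>M: "\<bar>\<sigma> \<alpha>\<bar> \<le> M"
      using c0(1) c0(2)[of \<alpha>] s(2)[OF _ \<alpha>(2)] by (cases "\<alpha> = \<alpha>_bar") (auto simp: M_def)
    have cl0: "curve_length 0 = 1" using curve_length_ge_1[of 0] curve_length_le[of 0] by simp
    have "\<bar>energy \<sigma> (u, \<alpha>) - energy \<sigma> (u_bar, \<alpha>_bar)\<bar>
        = \<bar>\<sigma> \<alpha> * (curve_length u - 1) + (\<sigma> \<alpha> - \<sigma> \<alpha>_bar)\<bar>"
      by (simp add: energy_def crit(1) cl0 algebra_simps)
    also have "\<dots> \<le> \<bar>\<sigma> \<alpha>\<bar> * (curve_length u - 1) + \<bar>\<sigma> \<alpha> - \<sigma> \<alpha>_bar\<bar>"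
      using abs_triangle_ineq[of "\<sigma> \<alpha> * (curve_length u - 1)"] curve_length_ge_1[of u]
      by (simp add: abs_mult)
    also have "\<bar>\<sigma> \<alpha>\<bar> * (curve_length u - 1) \<le> M * ((norm u)\<^sup>2 / 2)"
      using \<sigma>M curve_length_le[of u] curve_length_ge_1[of u] by (intro mult_mono) auto
    finally have 3: "\<bar>energy \<sigma> (u, \<alpha>) - energy \<sigma> (u_bar, \<alpha>_bar)\<bar>
        \<le> M * ((norm u)\<^sup>2 / 2) + \<bar>\<sigma> \<alpha> - \<sigma> \<alpha>_bar\<bar>" by simp
    have "(norm u)\<^sup>2 \<le> 1" using nu by (simp add: abs_square_le_1)
    then have "\<bar>energy \<sigma> (u, \<alpha>) - energy \<sigma> (u_bar, \<alpha>_bar)\<bar> powr (1 - \<theta>) \<le> K * N"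
      unfolding K_def using order_trans[OF norm_ge_zero NG]
      by (intro lojasiewicz_combine[OF _ _ _ M c0(1) loj(4,2,3) 1 2 _ 3]) auto
    then show ?thesis using K by (simp add: N_def[symmetric] field_simps)
  qed
  have "gradient (energy \<sigma>) p \<in> Y" if "p \<in> Y" for p
    using that in_H2_per_ave_gradient_fun by (cases p) (auto simp: Y_def grad)
  moreover have "gradient_fun \<sigma> u \<alpha> \<in> H_per_ave 1 \<and>
      (GDERIV (energy \<sigma>) (u, \<alpha>) :> (abs_h1 (gradient_fun \<sigma> u \<alpha>), deriv \<sigma> \<alpha> * curve_length u))" for u \<alpha>
    using gradient_fun_H_per_ave_1(1) energy_gradient[OF d\<sigma>] by blast
  moreover have "\<forall>(u, \<alpha>)\<in>U. norm_Y (gradient (energy \<sigma>) (u, \<alpha>))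
      \<ge> 1 / K * \<bar>energy \<sigma> (u, \<alpha>) - energy \<sigma> (u_bar, \<alpha>_bar)\<bar> powr (1 - \<theta>)"
    by (clarify, rule main)
  moreover have "0 < 1 / K" using K by simp
  ultimately show ?thesis using U loj(2,3) by blast
qed

end
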